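(* Let $\varphi$ be a pretty $\Sigma_1$ sentence. Then there are two computable functions $P_\mu$ and $P^{-1}_\mu$ (taking as arguments a program code and a sentence code and returning program codes) such that for every program $p$: (i) if $p\Vdash\varphi$ then $P_\mu(p,\varphi)\Vdash_\mu\varphi\ge1$; and (ii) if $p\Vdash_\mu\varphi$ then $P^{-1}_\mu(p,\varphi)\Vdash\varphi$. Consequently a pretty $\Sigma_1$ sentence is true (in $\mathbb N$) if and only if it is $\mu$-realised (i.e. some program $p$ satisfies $p\Vdash_\mu\varphi$). The same results hold for universal $\Pi_1$ sentences.
   Context: Sentences are in the first-order language of arithmetic ($0,S,+,\cdot,=$, with bounded quantifiers $\forall x<t$, $\exists x<t$). A formula is $\Delta_0$ if all its quantifiers are bounded. A sentence is pretty $\Sigma_1$ if it is $\Delta_0$ or of the form $Q_0\dots Q_n\psi$ with $\psi$ $\Delta_0$ and each $Q_i$ either an existential quantifier or a bounded universal quantifier. A sentence is universal $\Pi_1$ if it is $\Delta_0$ or of the form $\forall x_0\dots\forall x_n\psi$ with $\psi$ $\Delta_0$. Programs are oracle Turing programs, identified with natural-number codes via a fixed computable enumeration; for a program $p$, oracle $u\in 2^\omega$ and $n\in\mathbb N$, $p^u(n)$ is the output of $p$ on input $n$ with oracle $u$. Ordinary programs are identified with oracle programs never querying the oracle; for them $e(n)$ is the output on input $n$. $\mu$ is the Lebesgue (fair-coin) measure on $2^\omega$. Kleene realisability $e\Vdash\varphi$: never $e\Vdash\bot$; $e\Vdash t=s$ iff $t,s$ have the same value; $e\Vdash\varphi\wedge\psi$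 iff $e(0)\Vdash\varphi$ and $e(1)\Vdash\psi$; $e\Vdash\varphi\vee\psi$ iff $e(0)=0$ and $e(1)\Vdash\varphi$, or $e(0)=1$ and $e(1)\Vdash\psi$; $e\Vdash\varphi\to\psi$ iff for all $s\Vdash\varphi$, $e(s)\Vdash\psi$; $e\Vdash\exists x\varphi(x)$ iff $e(0)\Vdash\varphi(e(1))$; $e\Vdash\forall x\varphi(x)$ iff $e(n)\Vdash\varphi(n)$ for all $n$ (outputs mentioned must exist). $\mu$-realisability: $(p,u)\Vdash_O\varphi$ and $p\Vdash_\mu\varphi$ are defined by simultaneous recursion: never $(p,u)\Vdash_O\bot$; $(p,u)\Vdash_O t=s$ iff $t,s$ have the same value; $(p,u)\Vdash_O\varphi\wedge\psi$ iff $(p^u(0),u)\Vdash_O\varphi$ and $(p^u(1),u)\Vdash_O\psi$; $(p,u)\Vdash_O\varphi\vee\psi$ iff $p^u(0)=0$ and $(p^u(1),u)\Vdash_O\varphi$, or $p^u(0)=1$ and $(p^u(1),u)\Vdash_O\psi$; $(p,u)\Vdash_O\varphi\to\psi$ iff for every $s$ with $s\Vdash_\mu\varphi$, $p^u(s)\Vdash_\mu\psi$; $(p,u)\Vdash_O\exists x\varphi(x)$ iff $(p^u(0),u)\Vdash_O\varphi(p^u(1))$; $(p,u)\Vdash_O\forall x\varphi(x)$ iff $(p^u(n),u)\Vdash_O\varphi(n)$ for all $n$. Let $C_{p,\varphi}=\{u:(p,u)\Vdash_O\varphi\}$; $p\Vdash_\mu\varphi\ge r$ iff $\mu(C_{p,\varphi})\ge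 r$; $p\Vdash_\mu\varphi$ iff $p\Vdash_\mu\varphi\ge r$ for some $r>0$. *)

theory Defs
  imports "HOL-Probability.Probability" "HOL-Library.Nat_Bijection"
begin

section \<open>Arithmetic formulas\<close>

text \<open>
  Variables are de Bruijn indices: under a quantifier, \<open>Var 0\<close> is the bound variable.
  An assignment interprets the free variables, and \<open>case_nat n \<sigma>\<close> is the assignment
  used for the body of a quantifier instantiated at \<open>n\<close>. Negation is implication of \<open>Bot\<close>.
\<close>

datatype trm = Var nat | Zero | Succ trm | Plus trm trm | Times trm trm

datatype fm =
    Bot
  | Eq trm trm
  | And fm fm
  | Or fm fm
  | Imp fm fm
  | Ex fm
  | All fm

type_synonym assignment = "nat \<Rightarrow> nat"

primrec tval :: "assignment \<Rightarrow> trm \<Rightarrow> nat" where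
  "tval \<sigma> (Var i) = \<sigma> i"
| "tval \<sigma> Zero = 0"
| "tval \<sigma> (Succ t) = Suc (tval \<sigma> t)"
| "tval \<sigma> (Plus s t) = tval \<sigma> s + tval \<sigma> t"
| "tval \<sigma> (Times s t) = tval \<sigma> s * tval \<sigma> t"

primrec sat :: "assignment \<Rightarrow> fm \<Rightarrow> bool" where
  "sat \<sigma> Bot \<longleftrightarrow> False"
| "sat \<sigma> (Eq s t) \<longleftrightarrow> tval \<sigma> s = tval \<sigma> t"
| "sat \<sigma> (And \<phi> \<psi>) \<longleftrightarrow> sat \<sigma> \<phi> \<and> sat \<sigma> \<psi>"
| "sat \<sigma> (Or \<phi> \<psi>) \<longleftrightarrow> sat \<sigma> \<phi> \<or> sat \<sigma> \<psi>"
| "sat \<sigma> (Imp \<phi> \<psi>) \<longleftrightarrow> (sat \<sigma> \<phi> \<longrightarrow> sat \<sigma> \<psi>)"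
| "sat \<sigma> (Ex \<phi>) \<longleftrightarrow> (\<exists>n. sat (case_nat n \<sigma>) \<phi>)"
| "sat \<sigma> (All \<phi>) \<longleftrightarrow> (\<forall>n. sat (case_nat n \<sigma>) \<phi>)"

text \<open>\<open>closed_trm k\<close> and \<open>closed_fm k\<close>: all free variables are among \<open>0, \<dots>, k - 1\<close>.\<close>

primrec closed_trm :: "nat \<Rightarrow> trm \<Rightarrow> bool" where
  "closed_trm k (Var i) \<longleftrightarrow> i < k"
| "closed_trm k Zero \<longleftrightarrow> True"
| "closed_trm k (Succ t) \<longleftrightarrow> closed_trm k t"
| "closed_trm k (Plus s t) \<longleftrightarrow> closed_trm k s \<and> closed_trm k t"
| "closed_trm k (Times s t) \<longleftrightarrow> closed_trm k s \<and> closed_trm k t"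

primrec closed_fm :: "nat \<Rightarrow> fm \<Rightarrow> bool" where
  "closed_fm k Bot \<longleftrightarrow> True"
| "closed_fm k (Eq s t) \<longleftrightarrow> closed_trm k s \<and> closed_trm k t"
| "closed_fm k (And \<phi> \<psi>) \<longleftrightarrow> closed_fm k \<phi> \<and> closed_fm k \<psi>"
| "closed_fm k (Or \<phi> \<psi>) \<longleftrightarrow> closed_fm k \<phi> \<and> closed_fm k \<psi>"
| "closed_fm k (Imp \<phi> \<psi>) \<longleftrightarrow> closed_fm k \<phi> \<and> closed_fm k \<psi>"
| "closed_fm k (Ex \<phi>) \<longleftrightarrow> closed_fm (Suc k) \<phi>"
| "closed_fm k (All \<phi>) \<longleftrightarrow> closed_fm (Suc k) \<phi>"

definition sentence :: "fm \<Rightarrow> bool" where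
  "sentence \<phi> \<longleftrightarrow> closed_fm 0 \<phi>"

text \<open>For sentences the assignment is irrelevant.\<close>

definition true_in_N :: "fm \<Rightarrow> bool" where
  "true_in_N \<phi> \<longleftrightarrow> sat (\<lambda>_. 0) \<phi>"

text \<open>
  Bounded quantifiers are the usual abbreviations \<open>\<forall>x (x < t \<rightarrow> \<phi>)\<close> and
  \<open>\<exists>x (x < t \<and> \<phi>)\<close>, where \<open>s < t\<close> stands for \<open>\<exists>z (s + S z = t)\<close>. The bound \<open>t\<close> is
  lifted, so it cannot mention the variable being quantified.
\<close>

primrec lift_trm :: "trm \<Rightarrow> trm" where
  "lift_trm (Var i) = Var (Suc i)"
| "lift_trm Zero = Zero"
| "lift_trm (Succ t) = Succ (lift_trm t)"
| "lift_trm (Plus s t) = Plus (lift_trm s) (lift_trm t)"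
| "lift_trm (Times s t) = Times (lift_trm s) (lift_trm t)"

definition Less :: "trm \<Rightarrow> trm \<Rightarrow> fm" where
  "Less s t = Ex (Eq (Plus (lift_trm s) (Succ (Var 0))) (lift_trm t))"

definition BEx :: "trm \<Rightarrow> fm \<Rightarrow> fm" where
  "BEx t \<phi> = Ex (And (Less (Var 0) (lift_trm t)) \<phi>)"

definition BAll :: "trm \<Rightarrow> fm \<Rightarrow> fm" where
  "BAll t \<phi> = All (Imp (Less (Var 0) (lift_trm t)) \<phi>)"

inductive Delta0 :: "fm \<Rightarrow> bool" where
  "Delta0 Bot"
| "Delta0 (Eq s t)"
| "Delta0 \<phi> \<Longrightarrow> Delta0 \<psi> \<Longrightarrow> Delta0 (And \<phi> \<psi>)"
| "Delta0 \<phi> \<Longrightarrow> Delta0 \<psi> \<Longrightarrow> Delta0 (Or \<phi> \<psi>)"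
| "Delta0 \<phi> \<Longrightarrow> Delta0 \<psi> \<Longrightarrow> Delta0 (Imp \<phi> \<psi>)"
| "Delta0 \<phi> \<Longrightarrow> Delta0 (BEx t \<phi>)"
| "Delta0 \<phi> \<Longrightarrow> Delta0 (BAll t \<phi>)"

text \<open>A quantifier \<open>\<exists>x < t\<close> in the prefix counts as an existential quantifier.\<close>

inductive pretty_Sigma1_fm :: "fm \<Rightarrow> bool" where
  "Delta0 \<phi> \<Longrightarrow> pretty_Sigma1_fm \<phi>"
| "pretty_Sigma1_fm \<phi> \<Longrightarrow> pretty_Sigma1_fm (Ex \<phi>)"
| "pretty_Sigma1_fm \<phi> \<Longrightarrow> pretty_Sigma1_fm (BEx t \<phi>)"
| "pretty_Sigma1_fm \<phi> \<Longrightarrow> pretty_Sigma1_fm (BAll t \<phi>)"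

inductive universal_Pi1_fm :: "fm \<Rightarrow> bool" where
  "Delta0 \<phi> \<Longrightarrow> universal_Pi1_fm \<phi>"
| "universal_Pi1_fm \<phi> \<Longrightarrow> universal_Pi1_fm (All \<phi>)"

definition pretty_Sigma1 :: "fm \<Rightarrow> bool" where
  "pretty_Sigma1 \<phi> \<longleftrightarrow> sentence \<phi> \<and> pretty_Sigma1_fm \<phi>"

definition universal_Pi1 :: "fm \<Rightarrow> bool" where
  "universal_Pi1 \<phi> \<longleftrightarrow> sentence \<phi> \<and> universal_Pi1_fm \<phi>"

text \<open>Goedel numbers; the first component is a tag for the outermost constructor.\<close>

primrec trm_number :: "trm \<Rightarrow> nat" where
  "trm_number (Var i) = prod_encode (0, i)"
| "trm_number Zero = prod_encode (1, 0)"
| "trm_number (Succ t) = prod_encode (2, trm_number t)"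
| "trm_number (Plus s t) = prod_encode (3, prod_encode (trm_number s, trm_number t))"
| "trm_number (Times s t) = prod_encode (4, prod_encode (trm_number s, trm_number t))"

primrec fm_number :: "fm \<Rightarrow> nat" where
  "fm_number Bot = prod_encode (0, 0)"
| "fm_number (Eq s t) = prod_encode (1, prod_encode (trm_number s, trm_number t))"
| "fm_number (And \<phi> \<psi>) = prod_encode (2, prod_encode (fm_number \<phi>, fm_number \<psi>))"
| "fm_number (Or \<phi> \<psi>) = prod_encode (3, prod_encode (fm_number \<phi>, fm_number \<psi>))"
| "fm_number (Imp \<phi> \<psi>) = prod_encode (4, prod_encode (fm_number \<phi>, fm_number \<psi>))"
| "fm_number (Ex \<phi>) = prod_encode (5, fm_number \<phi>)"
| "fm_number (All \<phi>) = prod_encode (6, fm_number \<phi>)"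


section \<open>Oracle Turing programs\<close>

text \<open>
  Oracle Turing machines in the style of Davis. A program is a finite table of quadruples; the
  key is a pair (state, scanned symbol) and the last component(s) of the action are next states.
  \<open>Query y n\<close> asks the oracle about the number of 1s on the tape and continues in state \<open>y\<close> if
  the answer is positive and in state \<open>n\<close> otherwise. Symbol 0 is the blank, and the initial
  state is 0. If several quadruples have the same key, the first one counts. A program halts
  when no quadruple applies.
\<close>

datatype action = Write nat nat | MoveL nat | MoveR nat | Query nat nat

type_synonym program = "((nat \<times> nat) \<times> action) list"
type_synonym cantor = "nat \<Rightarrow> bool"
type_synonym tape = "int \<Rightarrow> nat"
type_synonym config = "nat \<times> int \<times> tape"

definition ones :: "tape \<Rightarrow> nat" where
  "ones T = card {i. T i = 1}"

fun step :: "program \<Rightarrow> cantor \<Rightarrow> config \<Rightarrow> config option" where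
  "step P u (q, h, T) =
    (case map_of P (q, T h) of
      None \<Rightarrow> None
    | Some (Write b q') \<Rightarrow> Some (q', h, T(h := b))
    | Some (MoveL q') \<Rightarrow> Some (q', h - 1, T)
    | Some (MoveR q') \<Rightarrow> Some (q', h + 1, T)
    | Some (Query y n) \<Rightarrow> Some (if u (ones T) then y else n, h, T))"

text \<open>Input \<open>n\<close> is a block of \<open>n\<close> 1s, with the head on its leftmost cell.\<close>

definition initial :: "nat \<Rightarrow> config" where
  "initial n = (0, 0, \<lambda>i. if 0 \<le> i \<and> i < int n then 1 else 0)"

text \<open>The output is the number of 1s on the tape when the program halts.\<close>

definition computes :: "program \<Rightarrow> cantor \<Rightarrow> nat \<Rightarrow> nat \<Rightarrow> bool" where
  "computes P u n m \<longleftrightarrow>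
    (\<exists>q h T. (\<lambda>c c'. step P u c = Some c')\<^sup>*\<^sup>* (initial n) (q, h, T) \<and>
             step P u (q, h, T) = None \<and> ones T = m)"

text \<open>The enumeration of programs: \<open>program_of\<close> is a bijection from the naturals to the programs.\<close>

definition action_of :: "nat \<Rightarrow> action" where
  "action_of k =
    (let (a, b) = prod_decode (k div 4) in
     if k mod 4 = 0 then Write a b
     else if k mod 4 = 1 then MoveL (k div 4)
     else if k mod 4 = 2 then MoveR (k div 4)
     else Query a b)"

definition quadruple_of :: "nat \<Rightarrow> (nat \<times> nat) \<times> action" where
  "quadruple_of k = (let (a, b) = prod_decode k in (prod_decode a, action_of b))"

definition program_of :: "nat \<Rightarrow> program" where
  "program_of p = map quadruple_of (list_decode p)"

text \<open>\<open>outp p u n m\<close> says that \<open>p\<^sup>u(n)\<close> is defined and equal to \<open>m\<close>.\<close>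

definition outp :: "nat \<Rightarrow> cantor \<Rightarrow> nat \<Rightarrow> nat \<Rightarrow> bool" where
  "outp p u n m \<longleftrightarrow> computes (program_of p) u n m"

definition ordinary :: "nat \<Rightarrow> bool" where
  "ordinary e \<longleftrightarrow> (\<forall>k y n. (k, Query y n) \<notin> set (program_of e))"

text \<open>
  \<open>out e n m\<close> says that \<open>e(n)\<close> is defined and equal to \<open>m\<close>. The choice of the oracle is
  irrelevant, since an ordinary program makes no queries.
\<close>

definition out :: "nat \<Rightarrow> nat \<Rightarrow> nat \<Rightarrow> bool" where
  "out e n m \<longleftrightarrow> ordinary e \<and> outp e (\<lambda>_. False) n m"

definition computable2 :: "(nat \<Rightarrow> nat \<Rightarrow> nat) \<Rightarrow> bool" where
  "computable2 f \<longleftrightarrow> (\<exists>e. \<forall>a b. out e (prod_encode (a, b)) (f a b))"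


section \<open>Kleene realisability\<close>

text \<open>
  Realisers are ordinary programs. The conjunct \<open>ordinary e\<close> is only written where it does not
  already follow from the existence of an output of \<open>e\<close>.
\<close>

primrec realises_at :: "assignment \<Rightarrow> nat \<Rightarrow> fm \<Rightarrow> bool" where
  "realises_at \<sigma> e Bot \<longleftrightarrow> False"
| "realises_at \<sigma> e (Eq s t) \<longleftrightarrow> ordinary e \<and> tval \<sigma> s = tval \<sigma> t"
| "realises_at \<sigma> e (And \<phi> \<psi>) \<longleftrightarrow>
    (\<exists>a. out e 0 a \<and> realises_at \<sigma> a \<phi>) \<and> (\<exists>b. out e 1 b \<and> realises_at \<sigma> b \<psi>)"
| "realises_at \<sigma> e (Or \<phi> \<psi>) \<longleftrightarrow>
    out e 0 0 \<and> (\<exists>a. out e 1 a \<and> realises_at \<sigma> a \<phi>) \<or>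
    out e 0 1 \<and> (\<exists>a. out e 1 a \<and> realises_at \<sigma> a \<psi>)"
| "realises_at \<sigma> e (Imp \<phi> \<psi>) \<longleftrightarrow>
    ordinary e \<and>
    (\<forall>s. realises_at \<sigma> s \<phi> \<longrightarrow> (\<exists>a. out e s a \<and> realises_at \<sigma> a \<psi>))"
| "realises_at \<sigma> e (Ex \<phi>) \<longleftrightarrow>
    (\<exists>a n. out e 0 a \<and> out e 1 n \<and> realises_at (case_nat n \<sigma>) a \<phi>)"
| "realises_at \<sigma> e (All \<phi>) \<longleftrightarrow>
    (\<forall>n. \<exists>a. out e n a \<and> realises_at (case_nat n \<sigma>) a \<phi>)"

definition realises :: "nat \<Rightarrow> fm \<Rightarrow> bool" where
  "realises e \<phi> \<longleftrightarrow> realises_at (\<lambda>_. 0) e \<phi>"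


section \<open>Realisability with random oracles\<close>

definition coin_measure :: "cantor measure" where
  "coin_measure = (\<Pi>\<^sub>M i\<in>UNIV. measure_pmf (bernoulli_pmf (1/2)))"

text \<open>
  All sets of oracles measured below are Borel, since \<open>{u. outp p u n m}\<close> is open and only
  countable Boolean operations are applied; so the value 0 that \<open>measure\<close> returns on
  non-measurable sets never matters.
\<close>

fun orealises_at :: "assignment \<Rightarrow> nat \<Rightarrow> cantor \<Rightarrow> fm \<Rightarrow> bool"
  and mrealises_at :: "assignment \<Rightarrow> nat \<Rightarrow> fm \<Rightarrow> bool" where
  "orealises_at \<sigma> p u Bot \<longleftrightarrow> False"
| "orealises_at \<sigma> p u (Eq s t) \<longleftrightarrow> tval \<sigma> s = tval \<sigma> t"
| "orealises_at \<sigma> p u (And \<phi> \<psi>) \<longleftrightarrow>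
    (\<exists>a. outp p u 0 a \<and> orealises_at \<sigma> a u \<phi>) \<and> (\<exists>b. outp p u 1 b \<and> orealises_at \<sigma> b u \<psi>)"
| "orealises_at \<sigma> p u (Or \<phi> \<psi>) \<longleftrightarrow>
    outp p u 0 0 \<and> (\<exists>a. outp p u 1 a \<and> orealises_at \<sigma> a u \<phi>) \<or>
    outp p u 0 1 \<and> (\<exists>a. outp p u 1 a \<and> orealises_at \<sigma> a u \<psi>)"
| "orealises_at \<sigma> p u (Imp \<phi> \<psi>) \<longleftrightarrow>
    (\<forall>s. mrealises_at \<sigma> s \<phi> \<longrightarrow> (\<exists>a. outp p u s a \<and> mrealises_at \<sigma> a \<psi>))"
| "orealises_at \<sigma> p u (Ex \<phi>) \<longleftrightarrow>
    (\<exists>a n. outp p u 0 a \<and> outp p u 1 n \<and> orealises_at (case_nat n \<sigma>) a u \<phi>)"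
| "orealises_at \<sigma> p u (All \<phi>) \<longleftrightarrow>
    (\<forall>n. \<exists>a. outp p u n a \<and> orealises_at (case_nat n \<sigma>) a u \<phi>)"
| "mrealises_at \<sigma> p \<phi> \<longleftrightarrow>
    (\<exists>r>0. measure coin_measure {u. orealises_at \<sigma> p u \<phi>} \<ge> r)"

definition C_set :: "nat \<Rightarrow> fm \<Rightarrow> cantor set" where
  "C_set p \<phi> = {u. orealises_at (\<lambda>_. 0) p u \<phi>}"

definition mu_realises_ge :: "nat \<Rightarrow> fm \<Rightarrow> real \<Rightarrow> bool" where
  "mu_realises_ge p \<phi> r \<longleftrightarrow> measure coin_measure (C_set p \<phi>) \<ge> r"

definition mu_realises :: "nat \<Rightarrow> fm \<Rightarrow> bool" where
  "mu_realises p \<phi> \<longleftrightarrow> (\<exists>r>0. mu_realises_ge p \<phi> r)"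

end

theory Submission
  imports Defs
begin

text \<open>
  For the formulas in question, being realised in either sense implies truth, so the given
  realiser carries no information and can be ignored: from the sentence alone one computes a
  canonical realiser that works whenever the sentence is true. It is an ordinary program, it
  answers disjunctions by evaluating the left disjunct, which is \<open>\<Delta>\<^sub>0\<close>, and it finds witnesses of
  existential quantifiers by searching simultaneously for the witness and a range to which the
  remaining unbounded quantifiers may be restricted. As it never queries the oracle, it realises
  a true sentence for all oracles, not just for almost all; soundness, in turn, only uses that
  a set of positive measure is nonempty. What remains is to see that
  the canonical realiser is computable; it returns codes of other canonical realisers, hence
  the recursion theorem.
\<close>

section \<open>Register programs and their compilation to Turing programs\<close>

text \<open>Soundness and completeness depend on each other because implication is contravariant: to
  see that a realised implication is true, its true antecedent must first be given a realiser, and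
  to realise a true implication, a realised antecedent must be known to be true. Bounded universal
  quantifiers fall under this as well, since the bound is itself a formula, \<open>Less\<close>,
  with an existential quantifier inside. Subformulas are open, so a canonical realiser is indexed by
  the number of a formula and by the code of an environment. No given realiser is ever run:
  canonical programs only evaluate formulas and write down numbers of one another, so self-reference
  comes down to an arithmetic s-m-n function on tables.\<close>

datatype com = Inc nat | Dec nat | Seq com com | If nat com com | While nat com

inductive bs :: "com \<Rightarrow> (nat \<Rightarrow> nat) \<Rightarrow> (nat \<Rightarrow> nat) \<Rightarrow> bool" where
  Inc: "bs (Inc r) s (s(r := Suc (s r)))"
| Dec: "bs (Dec r) s (s(r := s r - 1))"
| Seq: "bs a s s' \<Longrightarrow> bs b s' s'' \<Longrightarrow> bs (Seq a b) s s''"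
| IfT: "s r \<noteq> 0 \<Longrightarrow> bs a s s' \<Longrightarrow> bs (If r a b) s s'"
| IfF: "s r = 0 \<Longrightarrow> bs b s s' \<Longrightarrow> bs (If r a b) s s'"
| WhileF: "s r = 0 \<Longrightarrow> bs (While r a) s s"
| WhileT: "s r \<noteq> 0 \<Longrightarrow> bs a s s' \<Longrightarrow> bs (While r a) s' s'' \<Longrightarrow> bs (While r a) s s''"

primrec regs :: "com \<Rightarrow> nat set" where
  "regs (Inc r) = {r}"
| "regs (Dec r) = {r}"
| "regs (Seq a b) = regs a \<union> regs b"
| "regs (If r a b) = insert r (regs a \<union> regs b)"
| "regs (While r a) = insert r (regs a)"

lemma finite_regs: "finite (regs c)"
  by (induction c) auto

text \<open>
  Registers are kept in unary on parallel tracks of the tape: the symbol at cell \<open>i \<ge> 0\<close> is the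
  code of the set of the tracks of those registers whose value exceeds \<open>i\<close>. Track 1 is left out,
  so that the symbol 2 is free to mark the cell \<open>-1\<close>, where the head rests between instructions.
  Track 0 belongs to register 0, so that inputs and outputs have the format of \<open>computes\<close>.
\<close>

definition track :: "nat \<Rightarrow> nat" where
  "track r = (if r = 0 then 0 else Suc r)"

definition tape_of :: "(nat \<Rightarrow> nat) \<Rightarrow> tape" where
  "tape_of s = (\<lambda>i. if i = -1 then 2 else if i < 0 then 0
                    else set_encode (track ` {r. nat i < s r}))"

text \<open>A table is finite, so its rows must come from a finite alphabet: these are the symbols
  that can occur while only registers below \<open>d\<close> are nonzero.\<close>

definition symbols :: "nat \<Rightarrow> nat set" where
  "symbols d = insert 2 (set_encode ` Pow (track ` {..<d}))"

definition supp :: "nat \<Rightarrow> (nat \<Rightarrow> nat) \<Rightarrow> bool" where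
  "supp d s \<longleftrightarrow> (\<forall>r\<ge>d. s r = 0)"

definition marked :: "nat \<Rightarrow> nat \<Rightarrow> bool" where
  "marked r x \<longleftrightarrow> track r \<in> set_decode x"

text \<open>Rewriting the marker serves as a change of state without a move. The unconditional
  \<open>Write 2\<close> jumps in \<open>code\<close> are harmless for the same reason: they are
  reached only with the head on the marker.\<close>

definition home :: "nat \<Rightarrow> nat \<Rightarrow> nat \<Rightarrow> action" where
  "home n q x = (if x = 2 then Write 2 q else MoveL n)"

primrec clen :: "com \<Rightarrow> nat" where
  "clen (Inc r) = 2"
| "clen (Dec r) = 3"
| "clen (Seq a b) = clen b + clen a"
| "clen (If r a b) = clen b + (clen a + 2)"
| "clen (While r a) = clen a + 2"

text \<open>
  \<open>code c n\<close> lists the transition functions of the states \<open>n, \<dots>, n + clen c - 1\<close>. Control enters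
  at the largest of these states and leaves to \<open>n - 1\<close>, so that programs are stacked on top
  of each other.
\<close>

primrec code :: "com \<Rightarrow> nat \<Rightarrow> (nat \<Rightarrow> action) list" where
  "code (Inc r) n =
    [home n (n - 1),
     \<lambda>x. if x = 2 \<or> marked r x then MoveR (n + 1)
         else Write (set_encode (insert (track r) (set_decode x))) n]"
| "code (Dec r) n =
    [home n (n - 1),
     \<lambda>x. if x = 2 then Write 2 (n - 1)
         else Write (set_encode (set_decode x - {track r})) n,
     \<lambda>x. if x = 2 \<or> marked r x then MoveR (n + 2) else MoveL (n + 1)]"
| "code (Seq a b) n = code b n @ code a (n + clen b)"
| "code (If r a b) n =
    code b n @ [\<lambda>_. Write 2 (n - 1)] @ code a (n + clen b + 1) @
    [\<lambda>x. if x = 2 then MoveR (n + clen b + clen a + 1)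
         else if marked r x then MoveL (n + clen b + clen a) else MoveL (n + clen b - 1)]"
| "code (While r a) n =
    [\<lambda>_. Write 2 (n + clen a + 1)] @ code a (n + 1) @
    [\<lambda>x. if x = 2 then MoveR (n + clen a + 1)
         else if marked r x then MoveL (n + clen a) else MoveL (n - 1)]"

section \<open>Correctness of the compiled code\<close>

lemma length_code: "length (code c n) = clen c"
  by (induction c arbitrary: n) auto

text \<open>Correctness is stated relative to these entries alone, so that pieces of code, even ones
  made for different alphabets, can share one table.\<close>

definition has :: "program \<Rightarrow> nat \<Rightarrow> nat \<Rightarrow> (nat \<Rightarrow> action) list \<Rightarrow> bool" where
  "has P d n fs \<longleftrightarrow> (\<forall>i<length fs. \<forall>x\<in>symbols d. map_of P (n + i, x) = Some ((fs ! i) x))"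

lemma has_append: "has P d n (fs @ gs) \<longleftrightarrow> has P d n fs \<and> has P d (n + length fs) gs"
proof
  assume h: "has P d n (fs @ gs)"
  have "map_of P (n + length fs + i, x) = Some ((gs ! i) x)" if "i < length gs" "x \<in> symbols d" for i x
    using h[unfolded has_def, rule_format, of "length fs + i" x] that by (simp add: add.assoc)
  moreover have "map_of P (n + i, x) = Some ((fs ! i) x)" if "i < length fs" "x \<in> symbols d" for i x
    using h[unfolded has_def, rule_format, of i x] that by (simp add: nth_append)
  ultimately show "has P d n fs \<and> has P d (n + length fs) gs"
    by (auto simp: has_def)
next
  assume h: "has P d n fs \<and> has P d (n + length fs) gs"
  show "has P d n (fs @ gs)"
    unfolding has_def
  proof (intro allI impI ballI)
    fix i x assume "i < length (fs @ gs)" "x \<in> symbols d"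
    then show "map_of P (n + i, x) = Some (((fs @ gs) ! i) x)"
      using h[unfolded has_def, THEN conjunct1, rule_format, of i x]
        h[unfolded has_def, THEN conjunct2, rule_format, of "i - length fs" x]
      by (cases "i < length fs") (auto simp: nth_append)
  qed
qed

lemma has_Cons: "has P d n (f # fs) \<longleftrightarrow> (\<forall>x\<in>symbols d. map_of P (n, x) = Some (f x)) \<and> has P d (n + 1) fs"
  using has_append[of P d n "[f]" fs] by (simp add: has_def)

abbreviation reach :: "program \<Rightarrow> cantor \<Rightarrow> config \<Rightarrow> config \<Rightarrow> bool" where
  "reach P u \<equiv> (\<lambda>c c'. step P u c = Some c')\<^sup>*\<^sup>*"

lemma reach_step: "step P u c = Some c' \<Longrightarrow> reach P u c' c'' \<Longrightarrow> reach P u c c''"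
  by (rule converse_rtranclp_into_rtranclp)

lemma track_inj: "inj track"
  by (auto simp: track_def inj_def split: if_splits)

lemma track_neq_1 [simp]: "track r \<noteq> 1" "track r \<noteq> Suc 0" "Suc 0 \<noteq> track r"
  by (auto simp: track_def)

lemma set_decode_2: "set_decode 2 = {1}"
  using set_encode_inverse[of "{1}"] by simp

lemma not_marked_2 [simp]: "\<not> marked r 2"
  by (simp add: marked_def set_decode_2)

lemma supp_finite: "supp d s \<Longrightarrow> finite {r. i < s r}"
  by (rule finite_subset[of _ "{..<d}"]) (auto simp: supp_def not_less[symmetric])

lemma tape_cell: "tape_of s (int i) = set_encode (track ` {r. i < s r})"
  by (simp add: tape_of_def)

lemma tape_cell_symbols: "supp d s \<Longrightarrow> tape_of s (int i) \<in> symbols d"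
  by (auto simp: tape_cell symbols_def supp_def not_less[symmetric] intro!: imageI)

lemma decode_cell: "supp d s \<Longrightarrow> set_decode (tape_of s (int i)) = track ` {r. i < s r}"
  by (simp add: tape_cell set_encode_inverse supp_finite)

lemma tape_cell_neq_2: "supp d s \<Longrightarrow> tape_of s (int i) \<noteq> 2"
proof
  assume s: "supp d s" and "tape_of s (int i) = 2"
  then have "track ` {r. i < s r} = {1}"
    using decode_cell[OF s, of i] set_decode_2 by simp
  then have "1 \<in> track ` {r. i < s r}" by simp
  then show False by auto
qed

lemma marked_cell: "supp d s \<Longrightarrow> marked r (tape_of s (int i)) \<longleftrightarrow> i < s r"
  by (auto simp: marked_def decode_cell inj_image_mem_iff[OF track_inj])

lemma tape_home [simp]: "tape_of s (-1) = 2"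
  by (simp add: tape_of_def)

lemma symbols_2 [simp]: "2 \<in> symbols d"
  by (simp add: symbols_def)

lemma tape_upd_home [simp]: "(tape_of s)(-1 := 2) = tape_of s"
  by (auto simp: tape_of_def)

text \<open>In unary the marked cells of a track form an initial segment, so the first cell without
  the mark is the cell \<open>s r\<close>.\<close>

lemma go_right:
  assumes s: "supp d s"
    and P: "\<And>x. x \<in> symbols d \<Longrightarrow> x = 2 \<or> marked r x \<Longrightarrow> map_of P (q, x) = Some (MoveR q)"
    and j: "j \<le> s r"
  shows "reach P u (q, -1, tape_of s) (q, int j, tape_of s)"
  using j
proof (induction j)
  case 0
  show ?case by (rule r_into_rtranclp) (simp add: P)
next
  case (Suc j)
  have "step P u (q, int j, tape_of s) = Some (q, int (Suc j), tape_of s)"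
    using Suc by (simp add: P tape_cell_symbols[OF s] marked_cell[OF s] add.commute)
  with Suc show ?case by (meson Suc_leD rtranclp.rtrancl_into_rtrancl)
qed

lemma go_home:
  assumes s: "supp d s"
    and P: "\<And>x. x \<in> symbols d \<Longrightarrow> map_of P (n, x) = Some (home n q x)"
  shows "reach P u (n, int j, tape_of s) (q, -1, tape_of s)"
proof (induction j)
  case 0
  have 1: "step P u (n, int 0, tape_of s) = Some (n, -1, tape_of s)"
    using tape_cell_symbols[OF s, of 0] tape_cell_neq_2[OF s, of 0]
    by (simp add: P home_def)
  have 2: "step P u (n, -1, tape_of s) = Some (q, -1, tape_of s)"
    by (simp add: P home_def)
  show ?case
    by (rule reach_step[OF 1], rule reach_step[OF 2]) simp
next
  case (Suc j)
  have "step P u (n, int (Suc j), tape_of s) = Some (n, int j, tape_of s)"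
    using tape_cell_symbols[OF s, of "Suc j"] tape_cell_neq_2[OF s, of "Suc j"]
    by (simp add: P home_def)
  then show ?case using Suc by (rule reach_step)
qed

text \<open>In unary an increment changes one cell only, the first one that lacks the mark.\<close>

lemma tape_inc:
  assumes "supp d s"
  shows "(tape_of s)(int (s r) := set_encode (insert (track r) (set_decode (tape_of s (int (s r)))))) =
    tape_of (s(r := Suc (s r)))"
proof
  fix i :: int
  consider "i < 0" | "i = int (s r)" | j where "i = int j" "j \<noteq> s r"
    by (metis int_nat_eq nat_int not_less)
  then show "((tape_of s)(int (s r) := set_encode (insert (track r) (set_decode (tape_of s (int (s r))))))) i =
    tape_of (s(r := Suc (s r))) i"
  proof cases
    case 1
    then show ?thesis by (auto simp: tape_of_def)
  next
    case 2
    have "insert (track r) (track ` {r'. s r < s r'}) = track ` {r'. s r < (s(r := Suc (s r))) r'}"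
      by auto
    with 2 show ?thesis
      by (simp add: decode_cell[OF assms]) (simp add: tape_cell)
  next
    case 3
    then have "{r'. j < s r'} = {r'. j < (s(r := Suc (s r))) r'}"
      by auto
    with 3 show ?thesis by (simp add: tape_cell)
  qed
qed

lemma tape_dec:
  assumes "supp d s" "s r = Suc k"
  shows "(tape_of s)(int k := set_encode (set_decode (tape_of s (int k)) - {track r})) =
    tape_of (s(r := k))"
proof
  fix i :: int
  consider "i < 0" | "i = int k" | j where "i = int j" "j \<noteq> k"
    by (metis int_nat_eq nat_int not_less)
  then show "((tape_of s)(int k := set_encode (set_decode (tape_of s (int k)) - {track r}))) i =
    tape_of (s(r := k)) i"
  proof cases
    case 1
    then show ?thesis by (auto simp: tape_of_def)
  next
    case 2
    have "track ` {r'. k < s r'} - {track r} = track ` {r'. k < (s(r := k)) r'}"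
      by (auto simp: inj_eq[OF track_inj])
    with 2 show ?thesis
      by (simp add: decode_cell[OF assms(1)]) (simp add: tape_cell)
  next
    case 3
    then have "{r'. j < s r'} = {r'. j < (s(r := k)) r'}"
      using assms by auto
    with 3 show ?thesis by (simp add: tape_cell)
  qed
qed

lemma supp_upd: "supp d s \<Longrightarrow> r < d \<Longrightarrow> supp d (s(r := k))"
  by (auto simp: supp_def)

lemma code_Inc_correct:
  assumes s: "supp d s" and r: "r < d" and P: "has P d n (code (Inc r) n)"
  shows "reach P u (n + 1, -1, tape_of s) (n - 1, -1, tape_of (s(r := Suc (s r))))"
proof -
  let ?s = "s(r := Suc (s r))"
  have P0: "map_of P (n, x) = Some (home n (n - 1) x)" if "x \<in> symbols d" for x
    using P that by (simp add: has_Cons)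
  have P1: "map_of P (n + 1, x) = Some (if x = 2 \<or> marked r x then MoveR (n + 1)
         else Write (set_encode (insert (track r) (set_decode x))) n)" if "x \<in> symbols d" for x
    using P that by (simp add: has_Cons)
  have 1: "reach P u (n + 1, -1, tape_of s) (n + 1, int (s r), tape_of s)"
    by (rule go_right[OF s]) (auto simp: P1 simp del: One_nat_def add_Suc_right)
  have 2: "step P u (n + 1, int (s r), tape_of s) = Some (n, int (s r), tape_of ?s)"
    using P1[OF tape_cell_symbols[OF s, of "s r"]] tape_cell_neq_2[OF s, of "s r"]
      marked_cell[OF s, of r "s r"]
    by (simp add: tape_inc[OF s])
  have 3: "reach P u (n, int (s r), tape_of ?s) (n - 1, -1, tape_of ?s)"
    by (rule go_home[OF supp_upd[OF s r] P0])
  show ?thesis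
    using 1 reach_step[OF 2 3] by (rule rtranclp_trans)
qed

lemma code_Dec_correct:
  assumes s: "supp d s" and r: "r < d" and P: "has P d n (code (Dec r) n)"
  shows "reach P u (n + 2, -1, tape_of s) (n - 1, -1, tape_of (s(r := s r - 1)))"
proof -
  let ?s = "s(r := s r - 1)"
  have P0: "map_of P (n, x) = Some (home n (n - 1) x)" if "x \<in> symbols d" for x
    using P that by (simp add: has_Cons)
  have P1: "map_of P (n + 1, x) = Some (if x = 2 then Write 2 (n - 1)
         else Write (set_encode (set_decode x - {track r})) n)" if "x \<in> symbols d" for x
    using P that by (simp add: has_Cons)
  have P2: "map_of P (n + 2, x) = Some (if x = 2 \<or> marked r x then MoveR (n + 2) else MoveL (n + 1))"
    if "x \<in> symbols d" for x
    using P that by (simp add: has_Cons)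
  have 1: "reach P u (n + 2, -1, tape_of s) (n + 2, int (s r), tape_of s)"
    by (rule go_right[OF s]) (auto simp: P2 simp del: One_nat_def add_Suc_right add_2_eq_Suc')
  have 2: "step P u (n + 2, int (s r), tape_of s) = Some (n + 1, int (s r) - 1, tape_of s)"
    using P2[OF tape_cell_symbols[OF s, of "s r"]] tape_cell_neq_2[OF s, of "s r"]
      marked_cell[OF s, of r "s r"]
    by simp
  have 3: "reach P u (n + 1, int (s r) - 1, tape_of s) (n - 1, -1, tape_of ?s)"
  proof (cases "s r")
    case 0
    \<comment> \<open>With an empty register the step to the left lands on the marker, and the code
      exits without erasing anything: this is the truncated predecessor of 0.\<close>
    then have "step P u (n + 1, int (s r) - 1, tape_of s) = Some (n - 1, -1, tape_of ?s)"
      using P1[of 2] by (simp add: fun_upd_idem)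
    then show ?thesis by (rule r_into_rtranclp)
  next
    case (Suc k)
    have "step P u (n + 1, int k, tape_of s) = Some (n, int k, tape_of (s(r := k)))"
      using P1[OF tape_cell_symbols[OF s, of k]] tape_cell_neq_2[OF s, of k]
      by (simp add: tape_dec[OF s Suc])
    moreover have "reach P u (n, int k, tape_of (s(r := k))) (n - 1, -1, tape_of (s(r := k)))"
      by (rule go_home[OF supp_upd[OF s r] P0])
    ultimately show ?thesis
      using Suc reach_step by (metis diff_Suc_1 of_nat_Suc add_diff_cancel_left')
  qed
  show ?thesis
    using 1 reach_step[OF 2 3] by (rule rtranclp_trans)
qed

lemma bs_supp: "bs c s s' \<Longrightarrow> regs c \<subseteq> {..<d} \<Longrightarrow> supp d s \<Longrightarrow> supp d s'"
  by (induction rule: bs.induct) (auto simp: supp_upd)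

text \<open>A register is nonzero exactly if cell 0 bears its mark. The test state sees the marker
  first, which sends it one cell to the right, and then cell 0, from which it returns home.\<close>

lemma branch:
  assumes s: "supp d s"
    and P: "\<forall>x\<in>symbols d. map_of P (t, x) = Some (if x = 2 then MoveR t
         else if marked r x then MoveL q else MoveL q')"
  shows "reach P u (t, -1, tape_of s) (if s r \<noteq> 0 then q else q', -1, tape_of s)"
proof -
  have 1: "step P u (t, -1, tape_of s) = Some (t, 0, tape_of s)"
    using P by simp
  have 2: "step P u (t, 0, tape_of s) = Some (if s r \<noteq> 0 then q else q', -1, tape_of s)"
    using P tape_cell_symbols[OF s, of 0] tape_cell_neq_2[OF s, of 0] marked_cell[OF s, of r 0]
    by auto
  show ?thesis
    by (rule reach_step[OF 1], rule r_into_rtranclp, rule 2)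
qed

text \<open>The induction is on the execution rather than on the program, because a loop that has
  run its body is entered again unchanged.\<close>

lemma code_correct:
  "bs c s s' \<Longrightarrow> regs c \<subseteq> {..<d} \<Longrightarrow> supp d s \<Longrightarrow> has P d n (code c n) \<Longrightarrow>
    reach P u (n + clen c - 1, -1, tape_of s) (n - 1, -1, tape_of s')"
proof (induction arbitrary: n rule: bs.induct)
  case (Inc r s)
  then show ?case using code_Inc_correct[of d s r P n u] by (simp add: fun_upd_def)
next
  case (Dec r s)
  then show ?case using code_Dec_correct[of d s r P n u] by (simp add: fun_upd_def)
next
  case (Seq a s s' b s'')
  from Seq.prems(3) have Pb: "has P d n (code b n)" and Pa: "has P d (n + clen b) (code a (n + clen b))"
    by (auto simp: has_append length_code)
  have "supp d s'" using bs_supp Seq by auto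
  then have "reach P u (n + clen b - 1, -1, tape_of s') (n - 1, -1, tape_of s'')"
    using Seq.IH(2) Pb Seq.prems by auto
  moreover have "reach P u (n + clen b + clen a - 1, -1, tape_of s) (n + clen b - 1, -1, tape_of s')"
    using Seq.IH(1) Pa Seq.prems by auto
  ultimately show ?case
    using rtranclp_trans by (fastforce simp: add.assoc)
next
  case (IfT s r a s' b)
  from IfT.prems(3) have Pj: "\<forall>x\<in>symbols d. map_of P (n + clen b, x) = Some (Write 2 (n - 1))"
    and Pa: "has P d (n + clen b + 1) (code a (n + clen b + 1))"
    and Pt: "\<forall>x\<in>symbols d. map_of P (n + clen b + clen a + 1, x) = Some (if x = 2 then MoveR (n + clen b + clen a + 1)
         else if marked r x then MoveL (n + clen b + clen a) else MoveL (n + clen b - 1))"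
    by (auto simp: has_append has_Cons length_code ac_simps)
  have 1: "reach P u (n + clen b + clen a + 1, -1, tape_of s) (n + clen b + clen a, -1, tape_of s)"
    using branch[OF IfT.prems(2) Pt] IfT.hyps by simp
  have 2: "reach P u (n + clen b + clen a, -1, tape_of s) (n + clen b, -1, tape_of s')"
    using IfT.IH[OF _ IfT.prems(2) Pa] IfT.prems by simp
  have 3: "step P u (n + clen b, -1, tape_of s') = Some (n - 1, -1, tape_of s')"
    using Pj by simp
  show ?case
    using rtranclp_trans[OF 1 rtranclp.rtrancl_into_rtrancl[OF 2 3]] by (simp add: add.assoc)
next
  case (IfF s r b s' a)
  from IfF.prems(3) have Pb: "has P d n (code b n)"
    and Pt: "\<forall>x\<in>symbols d. map_of P (n + clen b + clen a + 1, x) = Some (if x = 2 then MoveR (n + clen b + clen a + 1)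
         else if marked r x then MoveL (n + clen b + clen a) else MoveL (n + clen b - 1))"
    by (auto simp: has_append has_Cons length_code ac_simps)
  have 1: "reach P u (n + clen b + clen a + 1, -1, tape_of s) (n + clen b - 1, -1, tape_of s)"
    using branch[OF IfF.prems(2) Pt] IfF.hyps by simp
  have 2: "reach P u (n + clen b - 1, -1, tape_of s) (n - 1, -1, tape_of s')"
    using IfF.IH[OF _ IfF.prems(2) Pb] IfF.prems by simp
  show ?case
    using rtranclp_trans[OF 1 2] by (simp add: add.assoc)
next
  case (WhileF s r a)
  from WhileF.prems(3) have
    Pt: "\<forall>x\<in>symbols d. map_of P (n + clen a + 1, x) = Some (if x = 2 then MoveR (n + clen a + 1)
         else if marked r x then MoveL (n + clen a) else MoveL (n - 1))"
    by (auto simp: has_append has_Cons length_code ac_simps)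
  show ?case
    using branch[OF WhileF.prems(2) Pt, of u] WhileF.hyps by simp
next
  case (WhileT s r a s' s'')
  from WhileT.prems(3) have Pj: "\<forall>x\<in>symbols d. map_of P (n, x) = Some (Write 2 (n + clen a + 1))"
    and Pa: "has P d (n + 1) (code a (n + 1))"
    and Pt: "\<forall>x\<in>symbols d. map_of P (n + clen a + 1, x) = Some (if x = 2 then MoveR (n + clen a + 1)
         else if marked r x then MoveL (n + clen a) else MoveL (n - 1))"
    by (auto simp: has_append has_Cons length_code ac_simps)
  have s': "supp d s'" using bs_supp WhileT by auto
  have 1: "reach P u (n + clen a + 1, -1, tape_of s) (n + clen a, -1, tape_of s)"
    using branch[OF WhileT.prems(2) Pt] WhileT.hyps by simp
  have 2: "reach P u (n + clen a, -1, tape_of s) (n, -1, tape_of s')"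
    using WhileT.IH(1)[OF _ WhileT.prems(2) Pa] WhileT.prems by simp
  have 3: "step P u (n, -1, tape_of s') = Some (n + clen a + 1, -1, tape_of s')"
    using Pj by simp
  have 4: "reach P u (n + clen a + 1, -1, tape_of s') (n - 1, -1, tape_of s'')"
    using WhileT.IH(2)[OF WhileT.prems(1) s' WhileT.prems(3)] by simp
  show ?case
    using rtranclp_trans[OF 1 rtranclp_trans[OF 2 reach_step[OF 3 4]]] by simp
qed

section \<open>Computable functions\<close>

lemma bs_eq: "bs c s t \<Longrightarrow> t = t' \<Longrightarrow> bs c s t'"
  by simp

definition clear :: "nat \<Rightarrow> com" where
  "clear k = While k (Dec k)"

definition move :: "nat \<Rightarrow> nat \<Rightarrow> com" where
  "move k l = While k (Seq (Dec k) (Inc l))"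

definition move2 :: "nat \<Rightarrow> nat \<Rightarrow> nat \<Rightarrow> com" where
  "move2 k l m = While k (Seq (Dec k) (Seq (Inc l) (Inc m)))"

lemma bs_clear: "bs (clear k) s (s(k := 0))"
  unfolding clear_def
proof (induction "s k" arbitrary: s)
  case 0
  then show ?case by (intro bs_eq[OF bs.WhileF]) auto
next
  case (Suc n)
  show ?case
    by (rule bs_eq[OF bs.WhileT[OF _ bs.Dec Suc.hyps(1)]]) (use Suc.hyps(2) in auto)
qed

lemma bs_move:
  assumes "k \<noteq> l"
  shows "bs (move k l) s (s(k := 0, l := s l + s k))"
  unfolding move_def
proof (induction "s k" arbitrary: s)
  case 0
  then show ?case by (intro bs_eq[OF bs.WhileF]) auto
next
  case (Suc n)
  show ?case
    by (rule bs_eq[OF bs.WhileT[OF _ bs.Seq[OF bs.Dec bs.Inc] Suc.hyps(1)]])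
      (use Suc.hyps(2) assms in auto)
qed

lemma bs_move2:
  assumes "k \<noteq> l" "k \<noteq> m" "l \<noteq> m"
  shows "bs (move2 k l m) s (s(k := 0, l := s l + s k, m := s m + s k))"
  unfolding move2_def
proof (induction "s k" arbitrary: s)
  case 0
  then show ?case by (intro bs_eq[OF bs.WhileF]) auto
next
  case (Suc n)
  show ?case
    by (rule bs_eq[OF bs.WhileT[OF _ bs.Seq[OF bs.Dec bs.Seq[OF bs.Inc bs.Inc]] Suc.hyps(1)]])
      (use Suc.hyps(2) assms in auto)
qed

text \<open>Reading a register empties it, so a copy needs the scratch register \<open>k + 2\<close>
  to restore the original.\<close>

definition dup :: "nat \<Rightarrow> com" where
  "dup k = Seq (move2 k (k + 1) (k + 2)) (move (k + 2) k)"

lemma bs_dup: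
  assumes "s (k + 1) = 0" "s (k + 2) = 0"
  shows "bs (dup k) s (s(k + 1 := s k))"
  unfolding dup_def
  by (rule bs_eq[OF bs.Seq[OF bs_move2 bs_move]]) (use assms in auto)

definition add_triangle :: "nat \<Rightarrow> nat \<Rightarrow> nat \<Rightarrow> com" where
  "add_triangle b c t = While b (Seq (move2 b t c) (Seq (move t b) (Dec b)))"

lemma bs_add_triangle:
  assumes "b \<noteq> c" "b \<noteq> t" "c \<noteq> t" "s t = 0"
  shows "bs (add_triangle b c t) s (s(b := 0, c := s c + triangle (s b)))"
  using assms(4) unfolding add_triangle_def
proof (induction "s b" arbitrary: s)
  case 0
  then show ?case by (intro bs_eq[OF bs.WhileF]) (auto simp: fun_eq_iff triangle_def)
next
  case (Suc n)
  show ?case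
    by (rule bs_eq[OF bs.WhileT[OF _ bs.Seq[OF bs_move2 bs.Seq[OF bs_move bs.Dec]] Suc.hyps(1)]])
      (use Suc.hyps(2) Suc.prems assms in \<open>auto simp: fun_eq_iff simp flip: Suc.hyps(2)\<close>)
qed

abbreviation pair :: "nat \<Rightarrow> nat \<Rightarrow> nat" where
  "pair a b \<equiv> prod_encode (a, b)"

definition pfst :: "nat \<Rightarrow> nat" where
  "pfst z = fst (prod_decode z)"

definition psnd :: "nat \<Rightarrow> nat" where
  "psnd z = snd (prod_decode z)"

lemma pfst_pair [simp]: "pfst (pair a b) = a" and psnd_pair [simp]: "psnd (pair a b) = b"
  by (simp_all add: pfst_def psnd_def)

lemma pair_collapse [simp]: "pair (pfst z) (psnd z) = z"
  by (simp add: pfst_def psnd_def)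

text \<open>Cantor's formula \<open>triangle (a + b) + a\<close>, with \<open>a\<close> in register
  \<open>k + 1\<close> and \<open>b\<close> in register \<open>k\<close>. In this order a parameter
  in register 1 and an input in register 0 become \<open>pair parameter input\<close>.\<close>

definition pair_com :: "nat \<Rightarrow> com" where
  "pair_com k = Seq (move2 (k + 1) k (k + 2)) (Seq (add_triangle k (k + 2) (k + 3)) (move (k + 2) k))"

lemma bs_pair_com:
  assumes "s (k + 2) = 0" "s (k + 3) = 0"
  shows "bs (pair_com k) s (s(k := pair (s (k + 1)) (s k), k + 1 := 0))"
  unfolding pair_com_def
  by (rule bs_eq[OF bs.Seq[OF bs_move2 bs.Seq[OF bs_add_triangle bs_move]]])
    (use assms in \<open>auto simp: fun_eq_iff prod_encode_def add.commute\<close>)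

text \<open>Inverts the pairing by counting along the diagonals: the successor of
  \<open>(a, b + 1)\<close> is \<open>(a + 1, b)\<close>, and that of \<open>(a, 0)\<close> is
  \<open>(0, a + 1)\<close>.\<close>

definition unpair_com :: "nat \<Rightarrow> com" where
  "unpair_com k = While k (Seq (Dec k)
    (If (k + 2) (Seq (Dec (k + 2)) (Inc (k + 1))) (Seq (move (k + 1) (k + 2)) (Inc (k + 2)))))"

lemma bs_unpair_com':
  "bs (unpair_com k) s (s(k := 0, k + 1 := pfst (pair (s (k + 1)) (s (k + 2)) + s k),
     k + 2 := psnd (pair (s (k + 1)) (s (k + 2)) + s k)))"
  unfolding unpair_com_def
proof (induction "s k" arbitrary: s)
  case 0
  then show ?case by (intro bs_eq[OF bs.WhileF]) auto
next
  case (Suc n)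
  show ?case
  proof (cases "s (k + 2)")
    case 0
    have "pair 0 (Suc (s (Suc k))) = Suc (pair (s (Suc k)) 0)"
      by (simp add: prod_encode_def)
    with Suc.hyps(2) 0 show ?thesis
      by (intro bs_eq[OF bs.WhileT[OF _ bs.Seq[OF bs.Dec bs.IfF[OF _ bs.Seq[OF bs_move bs.Inc]]] Suc.hyps(1)]])
        (auto simp: fun_eq_iff simp flip: Suc.hyps(2))
  next
    case (Suc b)
    have "pair (Suc (s (Suc k))) b = Suc (pair (s (Suc k)) (Suc b))"
      by (simp add: prod_encode_def)
    with Suc.hyps(2) Suc show ?thesis
      by (intro bs_eq[OF bs.WhileT[OF _ bs.Seq[OF bs.Dec bs.IfT[OF _ bs.Seq[OF bs.Dec bs.Inc]]] Suc.hyps(1)]])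
        (auto simp: fun_eq_iff simp flip: Suc.hyps(2))
  qed
qed

lemma bs_unpair_com:
  assumes "s (k + 1) = 0" "s (k + 2) = 0"
  shows "bs (unpair_com k) s (s(k := 0, k + 1 := pfst (s k), k + 2 := psnd (s k)))"
proof -
  have "pair 0 0 = 0" by (simp add: prod_encode_def)
  then show ?thesis using bs_unpair_com'[of k s] assms by simp
qed

text \<open>
  The calling convention: the registers above the argument are free workspace, zero before and
  after the call, and those below are preserved.
\<close>

definition implements :: "(nat \<Rightarrow> com) \<Rightarrow> nat set \<Rightarrow> (nat \<Rightarrow> nat) \<Rightarrow> bool" where
  "implements C D f \<longleftrightarrow> (\<forall>k s. s k \<in> D \<longrightarrow> (\<forall>r>k. s r = 0) \<longrightarrow> bs (C k) s (s(k := f (s k))))"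

text \<open>Partial functions appear as total functions of the logic with a set \<open>D\<close> on
  which the program has to terminate correctly. Unbounded search becomes \<open>LEAST\<close>,
  computed where a solution exists.\<close>

definition cmp_on :: "nat set \<Rightarrow> (nat \<Rightarrow> nat) \<Rightarrow> bool" where
  "cmp_on D f \<longleftrightarrow> (\<exists>C. implements C D f)"

abbreviation cmp :: "(nat \<Rightarrow> nat) \<Rightarrow> bool" where
  "cmp \<equiv> cmp_on UNIV"

lemma implementsD:
  "implements C D f \<Longrightarrow> s k \<in> D \<Longrightarrow> (\<And>r. r > k \<Longrightarrow> s r = 0) \<Longrightarrow> bs (C k) s (s(k := f (s k)))"
  by (simp add: implements_def)

lemma cmp_onI:
  assumes "\<And>k s. s k \<in> D \<Longrightarrow> (\<And>r. r > k \<Longrightarrow> s r = 0) \<Longrightarrow> bs (C k) s (s(k := f (s k)))"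
  shows "cmp_on D f"
  unfolding cmp_on_def implements_def using assms by blast

lemma cmp_on_subset: "cmp_on D f \<Longrightarrow> D' \<subseteq> D \<Longrightarrow> cmp_on D' f"
  unfolding cmp_on_def implements_def by blast

text \<open>There is no empty command; an increment undone by a decrement replaces it.\<close>

lemma cmp_id: "cmp (\<lambda>x. x)"
proof (rule cmp_onI)
  fix k :: nat and s :: "nat \<Rightarrow> nat"
  show "bs (Seq (Inc k) (Dec k)) s (s(k := s k))"
    by (rule bs_eq[OF bs.Seq[OF bs.Inc bs.Dec]]) auto
qed

lemma cmp_Suc': "cmp Suc"
  by (rule cmp_onI) (rule bs.Inc)

lemma cmp_on_comp:
  assumes "cmp_on D f" "cmp g"
  shows "cmp_on {x. g x \<in> D} (\<lambda>x. f (g x))"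
proof -
  from assms obtain F G where
    F: "implements F D f" and
    G: "implements G UNIV g"
    by (auto simp: cmp_on_def)
  show ?thesis
    by (rule cmp_onI[of _ "\<lambda>k. Seq (G k) (F k)"], rule bs_eq[OF bs.Seq[OF implementsD[OF G] implementsD[OF F]]]) auto
qed

lemma cmp_comp_on:
  assumes "cmp f" "cmp_on D g"
  shows "cmp_on D (\<lambda>x. f (g x))"
proof -
  from assms obtain F G where
    F: "implements F UNIV f" and
    G: "implements G D g"
    by (auto simp: cmp_on_def)
  show ?thesis
    by (rule cmp_onI[of _ "\<lambda>k. Seq (G k) (F k)"], rule bs_eq[OF bs.Seq[OF implementsD[OF G] implementsD[OF F]]]) auto
qed

lemma cmp_Suc: "cmp g \<Longrightarrow> cmp (\<lambda>x. Suc (g x))"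
  using cmp_comp_on[OF cmp_Suc'] .

lemma cmp_const: "cmp (\<lambda>x. c)"
proof (induction c)
  case 0
  show ?case by (rule cmp_onI) (rule bs_clear)
next
  case (Suc c)
  then show ?case by (rule cmp_Suc)
qed

lemma cmp_pred: "cmp g \<Longrightarrow> cmp (\<lambda>x. g x - 1)"
  by (rule cmp_comp_on[of "\<lambda>x. x - 1"]) (rule cmp_onI[of _ Dec], rule bs.Dec)

lemma cmp_pfst: assumes "cmp g" shows "cmp (\<lambda>x. pfst (g x))"
proof (rule cmp_comp_on[of pfst, OF cmp_onI assms])
  fix k :: nat and s :: "nat \<Rightarrow> nat"
  assume s: "\<And>r. r > k \<Longrightarrow> s r = 0"
  show "bs (Seq (unpair_com k) (Seq (clear (k + 2)) (move (k + 1) k))) s (s(k := pfst (s k)))"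
    by (rule bs_eq[OF bs.Seq[OF bs_unpair_com bs.Seq[OF bs_clear bs_move]]])
      (auto simp: fun_eq_iff s)
qed

lemma cmp_psnd: assumes "cmp g" shows "cmp (\<lambda>x. psnd (g x))"
proof (rule cmp_comp_on[of psnd, OF cmp_onI assms])
  fix k :: nat and s :: "nat \<Rightarrow> nat"
  assume s: "\<And>r. r > k \<Longrightarrow> s r = 0"
  show "bs (Seq (unpair_com k) (Seq (clear (k + 1)) (move (k + 2) k))) s (s(k := psnd (s k)))"
    by (rule bs_eq[OF bs.Seq[OF bs_unpair_com bs.Seq[OF bs_clear bs_move]]])
      (auto simp: fun_eq_iff s)
qed

lemma cmp_on_pair:
  assumes "cmp_on D f" "cmp_on D g"
  shows "cmp_on D (\<lambda>x. pair (f x) (g x))"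
proof -
  from assms obtain F G where
    F: "implements F D f" and
    G: "implements G D g"
    by (auto simp: cmp_on_def)
  show ?thesis
  proof (rule cmp_onI)
    fix k :: nat and s :: "nat \<Rightarrow> nat"
    assume D: "s k \<in> D" and s: "\<And>r. r > k \<Longrightarrow> s r = 0"
    \<comment> \<open>The convention demands empty registers above the argument. So \<open>G\<close>
      runs first, on the upper copy; its result is moved below the other copy, on which
      \<open>F\<close> can then run.\<close>
    show "bs (Seq (move2 k (k + 1) (k + 2)) (Seq (G (k + 2)) (Seq (move (k + 2) k) (Seq (F (k + 1))
        (pair_com k))))) s (s(k := pair (f (s k)) (g (s k))))"
      by (rule bs_eq[OF bs.Seq[OF bs_move2 bs.Seq[OF implementsD[OF G] bs.Seq[OF bs_move bs.Seq[OF implementsD[OF F] bs_pair_com]]]]])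
        (auto simp: fun_eq_iff s D)
  qed
qed

lemma cmp_on_If:
  assumes "cmp t" "cmp_on {x\<in>D. t x \<noteq> 0} f" "cmp_on {x\<in>D. t x = 0} g"
  shows "cmp_on D (\<lambda>x. if t x = 0 then g x else f x)"
proof -
  from assms obtain T F G where
    T: "implements T UNIV t" and
    F: "implements F {x\<in>D. t x \<noteq> 0} f" and
    G: "implements G {x\<in>D. t x = 0} g"
    by (auto simp: cmp_on_def)
  show ?thesis
  proof (rule cmp_onI)
    fix k :: nat and s :: "nat \<Rightarrow> nat"
    assume D: "s k \<in> D" and s: "\<And>r. r > k \<Longrightarrow> s r = 0"
    show "bs (Seq (dup k) (Seq (T (k + 1)) (If (k + 1) (Seq (clear (k + 1)) (F k)) (G k)))) s
      (s(k := if t (s k) = 0 then g (s k) else f (s k)))"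
    proof (cases "t (s k) = 0")
      case True
      then show ?thesis
        by (intro bs_eq[OF bs.Seq[OF bs_dup bs.Seq[OF implementsD[OF T] bs.IfF[OF _ implementsD[OF G]]]]])
          (auto simp: fun_eq_iff s D)
    next
      case False
      then show ?thesis
        by (intro bs_eq[OF bs.Seq[OF bs_dup bs.Seq[OF implementsD[OF T] bs.IfT[OF _ bs.Seq[OF bs_clear implementsD[OF F]]]]]])
          (auto simp: fun_eq_iff s D)
    qed
  qed
qed

lemma cmp_on_while:
  assumes "cmp t" "cmp h"
    and f: "\<And>x. x \<in> D \<Longrightarrow> \<exists>n. t ((h ^^ n) x) = 0 \<and> (\<forall>m<n. t ((h ^^ m) x) \<noteq> 0) \<and> f x = (h ^^ n) x"
  shows "cmp_on D f"
proof -
  from assms obtain T H where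
    T: "implements T UNIV t" and
    H: "implements H UNIV h"
    by (auto simp: cmp_on_def)
  let ?W = "\<lambda>k. While (k + 1) (Seq (clear (k + 1)) (Seq (H k) (Seq (dup k) (T (k + 1)))))"
  have W: "bs (?W k) s (s(k := (h ^^ n) (s k), k + 1 := 0))"
    if "t ((h ^^ n) (s k)) = 0" "\<forall>m<n. t ((h ^^ m) (s k)) \<noteq> 0" "s (k + 1) = t (s k)"
      "\<And>r. r > k + 1 \<Longrightarrow> s r = 0" for n k s
    using that
  proof (induction n arbitrary: s)
    case 0
    then show ?case by (intro bs_eq[OF bs.WhileF]) auto
  next
    case (Suc n)
    have 1: "t (s k) \<noteq> 0" using Suc.prems(2) by (metis funpow_0 zero_less_Suc)
    have 2: "\<forall>m<n. t ((h ^^ m) (h (s k))) \<noteq> 0"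
      using Suc.prems(2) by (metis Suc_less_eq comp_apply funpow_Suc_right)
    show ?case
      by (rule bs_eq[OF bs.WhileT[OF _ bs.Seq[OF bs_clear bs.Seq[OF implementsD[OF H] bs.Seq[OF bs_dup implementsD[OF T]]]]
              Suc.IH]])
        (use 1 2 Suc.prems in \<open>auto simp: fun_eq_iff funpow_swap1\<close>)
  qed
  show ?thesis
  proof (rule cmp_onI)
    fix k :: nat and s :: "nat \<Rightarrow> nat"
    assume D: "s k \<in> D" and s: "\<And>r. r > k \<Longrightarrow> s r = 0"
    from f[OF D] obtain n where n: "t ((h ^^ n) (s k)) = 0" "\<forall>m<n. t ((h ^^ m) (s k)) \<noteq> 0" "f (s k) = (h ^^ n) (s k)"
      by blast
    show "bs (Seq (dup k) (Seq (T (k + 1)) (?W k))) s (s(k := f (s k)))"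
      by (rule bs_eq[OF bs.Seq[OF bs_dup bs.Seq[OF implementsD[OF T] W[of n]]]])
        (use n s in \<open>auto simp: fun_eq_iff\<close>)
  qed
qed

definition iter_until :: "(nat \<Rightarrow> nat) \<Rightarrow> (nat \<Rightarrow> nat) \<Rightarrow> nat \<Rightarrow> nat" where
  "iter_until t h x = (h ^^ (LEAST n. t ((h ^^ n) x) = 0)) x"

lemma cmp_on_iter_until:
  assumes "cmp t" "cmp h"
  shows "cmp_on {x. \<exists>n. t ((h ^^ n) x) = 0} (iter_until t h)"
proof (rule cmp_on_while[OF assms])
  fix x assume "x \<in> {x. \<exists>n. t ((h ^^ n) x) = 0}"
  then show "\<exists>n. t ((h ^^ n) x) = 0 \<and> (\<forall>m<n. t ((h ^^ m) x) \<noteq> 0) \<and> iter_until t h x = (h ^^ n) x"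
    unfolding iter_until_def
    by (intro exI[of _ "LEAST n. t ((h ^^ n) x) = 0"]) (auto intro: LeastI dest: not_less_Least)
qed

text \<open>Stopping states are fixed points, so all later iterates agree with the first one at
  which the test vanishes, and minimality of \<open>n\<close> need not be tracked.\<close>

lemma iter_until_eq:
  assumes stop: "\<And>x. t x = 0 \<Longrightarrow> h x = x" and n: "t ((h ^^ n) x) = 0"
  shows "iter_until t h x = (h ^^ n) x"
proof -
  define m where "m = (LEAST n. t ((h ^^ n) x) = 0)"
  have m: "t ((h ^^ m) x) = 0"
    unfolding m_def using n by (rule LeastI)
  have "m \<le> n"
    unfolding m_def using n by (rule Least_le)
  have "(h ^^ (k + m)) x = (h ^^ m) x" for k
    by (induction k) (auto simp: stop m)
  from this[of "n - m"] \<open>m \<le> n\<close> show ?thesis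
    by (simp add: iter_until_def m_def)
qed

section \<open>Primitive recursion, arithmetic and decidable predicates\<close>

named_theorems cmp_intros

lemma cmp_comp: "cmp f \<Longrightarrow> cmp g \<Longrightarrow> cmp (\<lambda>x. f (g x))"
  by (rule cmp_comp_on)

lemma cmp_pair: "cmp f \<Longrightarrow> cmp g \<Longrightarrow> cmp (\<lambda>x. pair (f x) (g x))"
  by (rule cmp_on_pair)

lemma cmp_If_eq0: "cmp t \<Longrightarrow> cmp f \<Longrightarrow> cmp g \<Longrightarrow> cmp (\<lambda>x. if t x = 0 then f x else g x)"
  by (rule cmp_on_If, assumption) (erule cmp_on_subset, rule subset_UNIV)+

declare cmp_id [cmp_intros] cmp_const [cmp_intros] cmp_Suc [cmp_intros] cmp_pfst [cmp_intros]
  cmp_psnd [cmp_intros] cmp_pair [cmp_intros]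

text \<open>A counting loop on states made of \<open>x\<close>, the number of remaining rounds, the
  index \<open>i\<close> and the accumulator. The argument \<open>x\<close> is carried along because
  \<open>h\<close> may depend on it.\<close>

lemma cmp_rec:
  assumes a: "cmp a" and h: "cmp (\<lambda>z. h (pfst z) (pfst (psnd z)) (psnd (psnd z)))" and n: "cmp n"
  shows "cmp (\<lambda>x. rec_nat (a x) (h x) (n x))"
proof -
  define t where "t = (\<lambda>z. pfst (psnd z))"
  define st where "st = (\<lambda>z. pair (pfst z) (pair (pfst (psnd z) - 1) (pair (Suc (pfst (psnd (psnd z))))
    (h (pfst z) (pfst (psnd (psnd z))) (psnd (psnd (psnd z)))))))"
  define ini where "ini = (\<lambda>x. pair x (pair (n x) (pair 0 (a x))))"
  define res where "res = (\<lambda>z. pair (pfst z) (pair 0 (pair (pfst (psnd z))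
    (rec_nat (a (pfst z)) (h (pfst z)) (pfst (psnd z))))))"
  have h': "cmp (\<lambda>z. h (pfst z) (pfst (psnd (psnd z))) (psnd (psnd (psnd z))))"
    using cmp_comp[OF h, of "\<lambda>z. pair (pfst z) (psnd (psnd z))"] by (simp add: cmp_intros)
  have "cmp_on (range ini) res"
  proof (rule cmp_on_while[of t st])
    show "cmp t" unfolding t_def by (intro cmp_intros)
    show "cmp st" unfolding st_def by (intro cmp_intros cmp_pred h')
    fix z assume "z \<in> range ini"
    then obtain x where z: "z = ini x" by blast
    have *: "(st ^^ i) z = pair x (pair (n x - i) (pair i (rec_nat (a x) (h x) i)))" for i
      by (induction i) (auto simp: z ini_def st_def)
    show "\<exists>n. t ((st ^^ n) z) = 0 \<and> (\<forall>m<n. t ((st ^^ m) z) \<noteq> 0) \<and> res z = (st ^^ n) z"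
      by (rule exI[of _ "n x"]) (simp add: * t_def, simp add: z ini_def res_def)
  qed
  then have "cmp_on {x. ini x \<in> range ini} (\<lambda>x. res (ini x))"
    by (rule cmp_on_comp) (auto simp: ini_def intro!: cmp_intros a n)
  then have "cmp (\<lambda>x. res (ini x))" by simp
  then have "cmp (\<lambda>x. psnd (psnd (psnd (res (ini x)))))" by (intro cmp_intros)
  then show ?thesis by (simp add: res_def ini_def)
qed

lemma cmp_add [cmp_intros]: "cmp f \<Longrightarrow> cmp g \<Longrightarrow> cmp (\<lambda>x. f x + g x)"
proof -
  assume f: "cmp f" and g: "cmp g"
  have "cmp (\<lambda>x. rec_nat (f x) (\<lambda>i acc. Suc acc) (g x))"
    by (rule cmp_rec[OF f _ g]) (intro cmp_intros)
  moreover have "rec_nat a (\<lambda>i acc. Suc acc) b = a + b" for a b :: nat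
    by (induction b) auto
  ultimately show ?thesis by simp
qed

lemma cmp_diff [cmp_intros]: "cmp f \<Longrightarrow> cmp g \<Longrightarrow> cmp (\<lambda>x. f x - g x)"
proof -
  assume f: "cmp f" and g: "cmp g"
  have "cmp (\<lambda>x. rec_nat (f x) (\<lambda>i acc. acc - 1) (g x))"
    by (rule cmp_rec[OF f _ g]) (intro cmp_intros cmp_pred)
  moreover have "rec_nat a (\<lambda>i acc. acc - 1) b = a - b" for a b :: nat
    by (induction b) auto
  ultimately show ?thesis by simp
qed

lemma cmp_mult [cmp_intros]: "cmp f \<Longrightarrow> cmp g \<Longrightarrow> cmp (\<lambda>x. f x * g x)"
proof -
  assume f: "cmp f" and g: "cmp g"
  have "cmp (\<lambda>x. rec_nat 0 (\<lambda>i acc. acc + f x) (g x))"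
    by (rule cmp_rec[OF _ _ g]) (intro cmp_intros cmp_comp[OF f])+
  moreover have "rec_nat 0 (\<lambda>i acc. acc + a) b = a * b" for a b :: nat
    by (induction b) auto
  ultimately show ?thesis by simp
qed

lemma cmp_power [cmp_intros]: "cmp f \<Longrightarrow> cmp g \<Longrightarrow> cmp (\<lambda>x. f x ^ g x)"
proof -
  assume f: "cmp f" and g: "cmp g"
  have "cmp (\<lambda>x. rec_nat 1 (\<lambda>i acc. acc * f x) (g x))"
    by (rule cmp_rec[OF _ _ g]) (intro cmp_intros cmp_comp[OF f])+
  moreover have "rec_nat 1 (\<lambda>i acc. acc * a) b = a ^ b" for a b :: nat
    by (induction b) auto
  ultimately show ?thesis by simp
qed

definition decidable :: "(nat \<Rightarrow> bool) \<Rightarrow> bool" where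
  "decidable P \<longleftrightarrow> cmp (\<lambda>x. of_bool (P x))"

lemma cmp_of_bool [cmp_intros]: "decidable P \<Longrightarrow> cmp (\<lambda>x. of_bool (P x))"
  by (simp add: decidable_def)

lemma decidable_le [cmp_intros]: "cmp f \<Longrightarrow> cmp g \<Longrightarrow> decidable (\<lambda>x. f x \<le> g x)"
proof -
  assume "cmp f" "cmp g"
  then have "cmp (\<lambda>x. 1 - (f x - g x))" by (intro cmp_intros)
  moreover have "(1 - (a - b) :: nat) = of_bool (a \<le> b)" for a b :: nat by simp
  ultimately show ?thesis unfolding decidable_def by simp
qed

lemma decidable_conj [cmp_intros]: "decidable P \<Longrightarrow> decidable Q \<Longrightarrow> decidable (\<lambda>x. P x \<and> Q x)"
  unfolding decidable_def of_bool_conj by (rule cmp_mult)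

lemma decidable_not [cmp_intros]: "decidable P \<Longrightarrow> decidable (\<lambda>x. \<not> P x)"
proof -
  assume "decidable P"
  then have "cmp (\<lambda>x. 1 - of_bool (P x))" by (intro cmp_intros)
  moreover have "(1 - of_bool b :: nat) = of_bool (\<not> b)" for b by simp
  ultimately show ?thesis unfolding decidable_def by simp
qed

lemma decidable_disj [cmp_intros]: "decidable P \<Longrightarrow> decidable Q \<Longrightarrow> decidable (\<lambda>x. P x \<or> Q x)"
  using decidable_not[OF decidable_conj[OF decidable_not decidable_not], of P Q] by simp

lemma decidable_less [cmp_intros]: "cmp f \<Longrightarrow> cmp g \<Longrightarrow> decidable (\<lambda>x. f x < g x)"
  unfolding Suc_le_eq[symmetric] by (intro cmp_intros)

lemma decidable_eq [cmp_intros]: "cmp f \<Longrightarrow> cmp g \<Longrightarrow> decidable (\<lambda>x. f x = g x)"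
  unfolding eq_iff by (intro cmp_intros)

lemma cmp_If [cmp_intros]:
  assumes "decidable P" "cmp f" "cmp g"
  shows "cmp (\<lambda>x. if P x then f x else g x)"
proof -
  have "cmp (\<lambda>x. if of_bool (P x) = (0 :: nat) then g x else f x)"
    using assms by (intro cmp_If_eq0 cmp_intros)
  moreover have "(if of_bool (P x) = (0 :: nat) then g x else f x) = (if P x then f x else g x)" for x
    by simp
  ultimately show ?thesis by simp
qed

lemma cmp_on_Least:
  assumes "decidable (\<lambda>z. Q (pfst z) (psnd z))"
  shows "cmp_on {x. \<exists>y. Q x y} (\<lambda>x. LEAST y. Q x y)"
proof -
  let ?t = "\<lambda>z. of_bool (\<not> Q (pfst z) (psnd z)) :: nat" and ?h = "\<lambda>z. pair (pfst z) (Suc (psnd z))"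
  have "cmp_on ((\<lambda>x. pair x 0) ` {x. \<exists>y. Q x y}) (\<lambda>z. pair (pfst z) (LEAST y. Q (pfst z) y))"
  proof (rule cmp_on_while[of ?t ?h])
    show "cmp ?t" "cmp ?h" by (intro cmp_intros assms)+
    fix z assume "z \<in> (\<lambda>x. pair x 0) ` {x. \<exists>y. Q x y}"
    then obtain x where z: "z = pair x 0" and x: "\<exists>y. Q x y" by blast
    have iter: "(?h ^^ n) z = pair x n" for n
      by (induction n) (simp_all add: z)
    from x show "\<exists>n. ?t ((?h ^^ n) z) = 0 \<and> (\<forall>m<n. ?t ((?h ^^ m) z) \<noteq> 0) \<and>
        pair (pfst z) (LEAST y. Q (pfst z) y) = (?h ^^ n) z"
      unfolding iter by (intro exI[of _ "LEAST y. Q x y"]) (auto simp: z intro: LeastI dest: not_less_Least)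
  qed
  then have "cmp_on {x. pair x 0 \<in> (\<lambda>x. pair x 0) ` {x. \<exists>y. Q x y}}
      (\<lambda>x. pair (pfst (pair x 0)) (LEAST y. Q (pfst (pair x 0)) y))"
    by (rule cmp_on_comp) (intro cmp_intros)
  moreover have "{x. pair x 0 \<in> (\<lambda>x. pair x 0) ` {x. \<exists>y. Q x y}} = {x. \<exists>y. Q x y}"
    by (auto simp: image_iff)
  ultimately have "cmp_on {x. \<exists>y. Q x y} (\<lambda>x. pair x (LEAST y. Q x y))" by simp
  from cmp_comp_on[OF cmp_psnd[OF cmp_id] this] show ?thesis by simp
qed

text \<open>
  Recursion with an explicit stack. The value at \<open>x\<close> is computed by asking for the values at
  other arguments one after the other; \<open>q x j v w\<close> is the next move after \<open>j\<close> answers, the last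
  two of which are \<open>v\<close> and \<open>w\<close>: either \<open>pair 0 r\<close>, to return \<open>r\<close>, or \<open>pair 1 y\<close>, to ask for
  the value at \<open>y\<close>.
\<close>

inductive dialogue :: "(nat \<Rightarrow> nat \<Rightarrow> nat \<Rightarrow> nat \<Rightarrow> nat) \<Rightarrow> nat \<Rightarrow> nat \<Rightarrow> nat \<Rightarrow> nat \<Rightarrow> nat \<Rightarrow> bool"
  for q where
  return: "q x j v w = pair 0 r \<Longrightarrow> dialogue q x j v w r"
| ask: "q x j v w = pair 1 y \<Longrightarrow> dialogue q y 0 0 0 u \<Longrightarrow> dialogue q x (Suc j) u v r \<Longrightarrow>
    dialogue q x j v w r"

lemma pair_0_0 [simp]: "pair 0 0 = 0"
  by (simp add: prod_encode_def)

text \<open>A machine state is \<open>pair frame stack\<close>, where the stack 0 is empty. A state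
  is thus already a frame on top of a stack, so that pushing it is just \<open>Suc\<close>, and
  popping subtracts 1.\<close>

lemma cmp_dialogue:
  assumes q: "cmp (\<lambda>z. q (pfst z) (pfst (psnd z)) (pfst (psnd (psnd z))) (psnd (psnd (psnd z))))"
    and f: "\<And>x. dialogue q x 0 0 0 (f x)"
  shows "cmp f"
proof -
  define Q where "Q = (\<lambda>z. q (pfst z) (pfst (psnd z)) (pfst (psnd (psnd z))) (psnd (psnd (psnd z))))"
  define t where "t = (\<lambda>Z. pfst (Q (pfst Z)) + psnd Z)"
  define upd where "upd = (\<lambda>fr r. pair (pfst fr) (pair (Suc (pfst (psnd fr))) (pair r (pfst (psnd (psnd fr))))))"
  define h where "h = (\<lambda>Z. if pfst (Q (pfst Z)) \<noteq> 0 then pair (pair (psnd (Q (pfst Z))) 0) (Suc Z)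
    else if psnd Z = 0 then Z
    else pair (upd (pfst (psnd Z - 1)) (psnd (Q (pfst Z)))) (psnd (psnd Z - 1)))"
  have Q: "cmp Q" using q by (simp add: Q_def)
  have t: "cmp t" unfolding t_def by (intro cmp_intros cmp_comp[OF Q])
  have h: "cmp h" unfolding h_def upd_def by (intro cmp_intros cmp_comp[OF Q])
  have run: "\<exists>n fr. (h ^^ n) (pair (pair x (pair j (pair v w))) st) = pair fr st \<and> Q fr = pair 0 r"
    if "dialogue q x j v w r" for x j v w r st
    using that
  proof (induction arbitrary: st rule: dialogue.induct)
    case (return x j v w r)
    show ?case
      by (rule exI[of _ 0]) (auto simp: Q_def return)
  next
    case (ask x j v w y u r)
    let ?fr = "pair x (pair j (pair v w))"
    have 1: "h (pair ?fr st) = pair (pair y (pair 0 (pair 0 0))) (Suc (pair ?fr st))"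
      by (simp add: h_def Q_def ask.hyps)
    obtain n fr where n: "(h ^^ n) (pair (pair y (pair 0 (pair 0 0))) (Suc (pair ?fr st))) = pair fr (Suc (pair ?fr st))"
      and fr: "Q fr = pair 0 u"
      using ask.IH(1) by blast
    have 2: "h (pair fr (Suc (pair ?fr st))) = pair (pair x (pair (Suc j) (pair u v))) st"
      by (simp add: h_def fr upd_def)
    obtain n' fr' where n': "(h ^^ n') (pair (pair x (pair (Suc j) (pair u v))) st) = pair fr' st"
      and fr': "Q fr' = pair 0 r"
      using ask.IH(2) by blast
    \<comment> \<open>One step pushes the frame, \<open>n\<close> steps run the inner dialogue, one
      step pops and records the answer, and \<open>n'\<close> steps finish.\<close>
    have "(h ^^ (n' + (Suc (n + 1)))) (pair ?fr st) = pair fr' st"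
      unfolding funpow_add comp_apply funpow.simps(2) by (simp add: 1 n 2 n' del: pair_0_0)
    with fr' show ?case by blast
  qed
  have fin: "\<exists>n. t ((h ^^ n) (pair (pair x 0) 0)) = 0 \<and> psnd (Q (pfst ((h ^^ n) (pair (pair x 0) 0)))) = f x" for x
  proof -
    obtain n fr where "(h ^^ n) (pair (pair x 0) 0) = pair fr 0" "Q fr = pair 0 (f x)"
      using run[OF f[of x], of 0] by auto
    then show ?thesis by (intro exI[of _ n]) (simp add: t_def)
  qed
  have stop: "h Z = Z" if "t Z = 0" for Z
    using that by (simp add: t_def h_def)
  have eq: "psnd (Q (pfst (iter_until t h (pair (pair x 0) 0)))) = f x" for x
  proof -
    from fin[of x] obtain n where n: "t ((h ^^ n) (pair (pair x 0) 0)) = 0"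
      "psnd (Q (pfst ((h ^^ n) (pair (pair x 0) 0)))) = f x" by blast
    show ?thesis using iter_until_eq[of t h n, OF stop n(1)] n(2) by simp
  qed
  have "cmp_on {x. pair (pair x 0) 0 \<in> {x. \<exists>n. t ((h ^^ n) x) = 0}} (\<lambda>x. iter_until t h (pair (pair x 0) 0))"
    by (rule cmp_on_comp[OF cmp_on_iter_until[OF t h]]) (intro cmp_intros)
  moreover have "{x. pair (pair x 0) 0 \<in> {x. \<exists>n. t ((h ^^ n) x) = 0}} = UNIV"
    using fin by auto
  ultimately have "cmp (\<lambda>x. iter_until t h (pair (pair x 0) 0))" by simp
  then have "cmp (\<lambda>x. psnd (Q (pfst (iter_until t h (pair (pair x 0) 0)))))"
    by (intro cmp_intros cmp_comp[OF Q])
  then show ?thesis by (simp add: eq)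
qed

section \<open>Evaluation of formulas\<close>

text \<open>An environment is an unending right-nested pair. As 0 is \<open>pair 0 0\<close>, every
  number is an environment, 0 is the constant zero one, and pairing prepends a value just as
  \<open>case_nat\<close> does.\<close>

definition lookup :: "nat \<Rightarrow> assignment" where
  "lookup e i = pfst (rec_nat e (\<lambda>_ a. psnd a) i)"

lemma psnd_Suc: "psnd (rec_nat e (\<lambda>_ a. psnd a) i) = rec_nat (psnd e) (\<lambda>_ a. psnd a) i"
  by (induction i) auto

lemma lookup_pair: "lookup (pair n e) = case_nat n (lookup e)"
  by (rule ext) (auto simp: lookup_def psnd_Suc split: nat.split)

lemma pfst_le: "pfst z \<le> z"
  using le_prod_encode_1[of "pfst z" "psnd z"] by simp

lemma psnd_le: "psnd z \<le> z"
  using le_prod_encode_2[of "psnd z" "pfst z"] by simp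

lemma pfst_0 [simp]: "pfst 0 = 0" and psnd_0 [simp]: "psnd 0 = 0"
  using pfst_le[of 0] psnd_le[of 0] by simp_all

text \<open>The reason why the evaluators terminate. Tag 0 must be a leaf, since decoding need not
  decrease there: \<open>pair 0 1\<close> is 1.\<close>

lemma psnd_less: "pfst z \<noteq> 0 \<Longrightarrow> psnd z < z"
proof -
  assume "pfst z \<noteq> 0"
  then have "psnd z < pair (pfst z) (psnd z)"
    unfolding prod_encode_def by (cases "pfst z") auto
  then show ?thesis by simp
qed

lemma pfst_psnd_less: "pfst z \<noteq> 0 \<Longrightarrow> pfst (psnd z) < z"
  and psnd_psnd_less: "pfst z \<noteq> 0 \<Longrightarrow> psnd (psnd z) < z"
  using le_less_trans[OF pfst_le psnd_less] le_less_trans[OF psnd_le psnd_less] by auto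

lemma lookup_0: "lookup 0 = (\<lambda>_. 0)"
proof
  fix i
  have "rec_nat 0 (\<lambda>_ a. psnd a) i = 0" by (induction i) auto
  then show "lookup 0 i = 0" by (simp add: lookup_def)
qed

lemma lookup_le: "lookup e i \<le> e"
proof -
  have "rec_nat e (\<lambda>_ a. psnd a) i \<le> e"
    by (induction i) (auto intro: le_trans[OF psnd_le])
  then show ?thesis unfolding lookup_def using pfst_le le_trans by blast
qed

lemma cmp_lookup [cmp_intros]: "cmp f \<Longrightarrow> cmp g \<Longrightarrow> cmp (\<lambda>x. lookup (f x) (g x))"
  unfolding lookup_def by (intro cmp_intros cmp_rec)

text \<open>Numbers that code no term get a value as well, tags above 4 being read as products; this
  keeps the function total.\<close>

function eval_trm :: "nat \<Rightarrow> nat \<Rightarrow> nat" where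
  "eval_trm e c =
    (if pfst c = 0 then lookup e (psnd c)
     else if pfst c = 1 then 0
     else if pfst c = 2 then Suc (eval_trm e (psnd c))
     else if pfst c = 3 then eval_trm e (pfst (psnd c)) + eval_trm e (psnd (psnd c))
     else eval_trm e (pfst (psnd c)) * eval_trm e (psnd (psnd c)))"
  by pat_completeness auto
termination
  by (relation "Wellfounded.measure snd")
    (simp_all add: psnd_less pfst_psnd_less psnd_psnd_less)

declare eval_trm.simps [simp del]

lemma eval_trm: "eval_trm e (trm_number t) = tval (lookup e) t"
  by (induction t) (simp_all add: eval_trm.simps[of _ "pair _ _"])

lemma cmp_eval_trm [cmp_intros]:
  assumes "cmp f" "cmp g"
  shows "cmp (\<lambda>x. eval_trm (f x) (g x))"
proof -
  define q where "q = (\<lambda>x (j::nat) v (w::nat).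
    if pfst (psnd x) = 0 then pair 0 (lookup (pfst x) (psnd (psnd x)))
    else if pfst (psnd x) = 1 then pair 0 0
    else if pfst (psnd x) = 2 then
      if j = 0 then pair 1 (pair (pfst x) (psnd (psnd x))) else pair 0 (Suc v)
    else if j = 0 then pair 1 (pair (pfst x) (pfst (psnd (psnd x))))
    else if j = 1 then pair 1 (pair (pfst x) (psnd (psnd (psnd x))))
    else pair 0 (if pfst (psnd x) = 3 then w + v else w * v))"
  have dlg: "dialogue q (pair e c) 0 0 0 (eval_trm e c)" for e c
  proof (induction c rule: less_induct)
    case (less c)
    note ev = eval_trm.simps[of e c]
    consider "pfst c = 0" | "pfst c = 1" | "pfst c = 2" | "pfst c > 2" by linarith
    then show ?case
    proof cases
      case 3
      then have IH: "dialogue q (pair e (psnd c)) 0 0 0 (eval_trm e (psnd c))"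
        using less[OF psnd_less] by simp
      show ?thesis
        by (rule dialogue.ask[OF _ IH dialogue.return]) (simp_all add: q_def 3 ev)
    next
      case 4
      then have IH: "dialogue q (pair e (pfst (psnd c))) 0 0 0 (eval_trm e (pfst (psnd c)))"
        "dialogue q (pair e (psnd (psnd c))) 0 0 0 (eval_trm e (psnd (psnd c)))"
        using less[OF pfst_psnd_less] less[OF psnd_psnd_less] by simp_all
      show ?thesis
        by (rule dialogue.ask[OF _ IH(1) dialogue.ask[OF _ IH(2) dialogue.return]])
          (use 4 in \<open>simp_all add: q_def ev\<close>)
    qed (simp_all add: q_def ev dialogue.return)
  qed
  then have "dialogue q x 0 0 0 (eval_trm (pfst x) (psnd x))" for x
    using dlg[of "pfst x" "psnd x"] by simp
  moreover have "cmp (\<lambda>z. q (pfst z) (pfst (psnd z)) (pfst (psnd (psnd z))) (psnd (psnd (psnd z))))"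
    unfolding q_def by (intro cmp_intros)
  ultimately have "cmp (\<lambda>x. eval_trm (pfst x) (psnd x))"
    by (rule cmp_dialogue[rotated])
  from cmp_comp[OF this cmp_pair[OF assms]] show ?thesis by simp
qed

text \<open>
  The evaluator restricts all quantifiers to a range. Its size has two parts: the second one
  exceeds the values of all terms in the formula, so that bounded quantifiers are evaluated
  correctly for all \<open>N\<close>, and \<open>N\<close> makes room for the witnesses of unbounded existential
  quantifiers.
\<close>

definition range_size :: "nat \<Rightarrow> nat \<Rightarrow> nat \<Rightarrow> nat" where
  "range_size N e c = N + (e + 2) ^ (2 ^ c)"

function eval_fm :: "nat \<Rightarrow> nat \<Rightarrow> nat \<Rightarrow> bool" where
  "eval_fm N e c =
    (if pfst c = 0 then False
     else if pfst c = 1 then eval_trm e (pfst (psnd c)) = eval_trm e (psnd (psnd c))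
     else if pfst c = 2 then eval_fm N e (pfst (psnd c)) \<and> eval_fm N e (psnd (psnd c))
     else if pfst c = 3 then eval_fm N e (pfst (psnd c)) \<or> eval_fm N e (psnd (psnd c))
     else if pfst c = 4 then eval_fm N e (pfst (psnd c)) \<longrightarrow> eval_fm N e (psnd (psnd c))
     else if pfst c = 5 then \<exists>m<range_size N e c. eval_fm N (pair m e) (psnd c)
     else \<forall>m<range_size N e c. eval_fm N (pair m e) (psnd c))"
  by pat_completeness auto
termination
  by (relation "Wellfounded.measure (\<lambda>(N, e, c). c)")
    (simp_all add: psnd_less pfst_psnd_less psnd_psnd_less)

declare eval_fm.simps [simp del]

lemma decidable_eval_fm [cmp_intros]:
  assumes "cmp f" "cmp g" "cmp h"
  shows "decidable (\<lambda>x. eval_fm (f x) (g x) (h x))"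
proof -
  \<comment> \<open>For connectives, \<open>w\<close> and \<open>v\<close> end up as the values of
    the left and right subformula. For quantifiers, \<open>j\<close> is also the next instance to
    ask for. Since only two answers are remembered, the loop must stop at the first answer that
    decides the formula: 1 for \<open>Ex\<close>, 0 for \<open>All\<close>.\<close>
  define q where "q = (\<lambda>x (j::nat) v (w::nat).
    if pfst (psnd (psnd x)) = 0 then pair 0 0
    else if pfst (psnd (psnd x)) = 1 then
      pair 0 (of_bool (eval_trm (pfst (psnd x)) (pfst (psnd (psnd (psnd x)))) =
        eval_trm (pfst (psnd x)) (psnd (psnd (psnd (psnd x))))))
    else if pfst (psnd (psnd x)) < 5 then
      if j = 0 then pair 1 (pair (pfst x) (pair (pfst (psnd x)) (pfst (psnd (psnd (psnd x))))))
      else if j = 1 then pair 1 (pair (pfst x) (pair (pfst (psnd x)) (psnd (psnd (psnd (psnd x))))))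
      else pair 0 (of_bool (if pfst (psnd (psnd x)) = 2 then w \<noteq> 0 \<and> v \<noteq> 0
        else if pfst (psnd (psnd x)) = 3 then w \<noteq> 0 \<or> v \<noteq> 0 else w = 0 \<or> v \<noteq> 0))
    else if j \<noteq> 0 \<and> v = of_bool (pfst (psnd (psnd x)) = 5) then pair 0 v
    else if j < range_size (pfst x) (pfst (psnd x)) (psnd (psnd x)) then
      pair 1 (pair (pfst x) (pair (pair j (pfst (psnd x))) (psnd (psnd (psnd x)))))
    else pair 0 (of_bool (pfst (psnd (psnd x)) \<noteq> 5)))"
  have dlg: "dialogue q (pair N (pair e c)) 0 0 0 (of_bool (eval_fm N e c))" for N e c
  proof (induction c arbitrary: e rule: less_induct)
    case (less c)
    note ev = eval_fm.simps[of N e c]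
    consider "pfst c = 0" | "pfst c = 1" | "2 \<le> pfst c" "pfst c < 5" | "5 \<le> pfst c" by linarith
    then show ?case
    proof cases
      case 3
      then have IH:
        "dialogue q (pair N (pair e (pfst (psnd c)))) 0 0 0 (of_bool (eval_fm N e (pfst (psnd c))))"
        "dialogue q (pair N (pair e (psnd (psnd c)))) 0 0 0 (of_bool (eval_fm N e (psnd (psnd c))))"
        using less[OF pfst_psnd_less] less[OF psnd_psnd_less] by simp_all
      from 3 have "pfst c = 2 \<or> pfst c = 3 \<or> pfst c = 4" by auto
      then show ?thesis
        by (intro dialogue.ask[OF _ IH(1) dialogue.ask[OF _ IH(2) dialogue.return]])
          (elim disjE; simp add: q_def ev)+
    next
      case 4
      let ?r = "range_size N e c"
      have IH: "dialogue q (pair N (pair (pair m e) (psnd c))) 0 0 0 (of_bool (eval_fm N (pair m e) (psnd c)))"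
        for m
        using less[OF psnd_less] 4 by simp
      \<comment> \<open>The loop invariant: none of the first \<open>j\<close> instances has decided
        the formula.\<close>
      have "dialogue q (pair N (pair e c)) j v w (of_bool (eval_fm N e c))"
        if "j \<le> ?r" "\<forall>m<j. eval_fm N (pair m e) (psnd c) \<longleftrightarrow> pfst c \<noteq> 5"
          "j \<noteq> 0 \<Longrightarrow> v = of_bool (pfst c \<noteq> 5)" for j v w
        using that
      proof (induction "?r - j" arbitrary: j v w)
        case 0
        then show ?case
          using 4 by (intro dialogue.return) (auto simp: q_def ev)
      next
        case (Suc n)
        then have j: "j < ?r" by simp
        show ?case
        proof (rule dialogue.ask[OF _ IH])
          show "q (pair N (pair e c)) j v w = pair 1 (pair N (pair (pair j e) (psnd c)))"
            using 4 Suc.prems(3) j by (cases "j = 0") (auto simp: q_def)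
          show "dialogue q (pair N (pair e c)) (Suc j) (of_bool (eval_fm N (pair j e) (psnd c))) v (of_bool (eval_fm N e c))"
          proof (cases "eval_fm N (pair j e) (psnd c) \<longleftrightarrow> pfst c \<noteq> 5")
            case True
            show ?thesis
              by (rule Suc.hyps(1)) (use Suc.hyps(2) Suc.prems True j in \<open>auto simp: less_Suc_eq\<close>)
          next
            case False
            then show ?thesis
              using 4 j by (intro dialogue.return) (auto simp: q_def ev)
          qed
        qed
      qed
      then show ?thesis by simp
    qed (simp_all add: q_def ev dialogue.return)
  qed
  then have "dialogue q x 0 0 0 (of_bool (eval_fm (pfst x) (pfst (psnd x)) (psnd (psnd x))))" for x
    using dlg[of "pfst x" "pfst (psnd x)" "psnd (psnd x)"] by simp
  moreover have "cmp (\<lambda>z. q (pfst z) (pfst (psnd z)) (pfst (psnd (psnd z))) (psnd (psnd (psnd z))))"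
    unfolding q_def range_size_def if_bool_eq_disj by (intro cmp_intros)
  ultimately have "cmp (\<lambda>x. of_bool (eval_fm (pfst x) (pfst (psnd x)) (psnd (psnd x))))"
    by (rule cmp_dialogue[rotated])
  from cmp_comp[OF this cmp_pair[OF assms(1) cmp_pair[OF assms(2,3)]]] show ?thesis
    by (simp add: decidable_def)
qed

section \<open>Programs with a parameter\<close>

primrec rows :: "nat list \<Rightarrow> nat \<Rightarrow> (nat \<Rightarrow> action) list \<Rightarrow> program" where
  "rows S n [] = []"
| "rows S n (f # fs) = map (\<lambda>x. ((n, x), f x)) S @ rows S (Suc n) fs"

lemma map_of_row: "map_of (map (\<lambda>x. ((n, x), f x)) S) (q, x) = (if q = n \<and> x \<in> set S then Some (f x) else None)"
  by (induction S) auto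

lemma map_of_rows:
  "map_of (rows S n fs) (q, x) =
    (if n \<le> q \<and> q < n + length fs \<and> x \<in> set S then Some ((fs ! (q - n)) x) else None)"
proof (induction fs arbitrary: n)
  case (Cons f fs)
  show ?case
    by (auto simp: Cons map_of_row map_add_def nth_Cons' split: option.split)
qed simp

primrec number_action :: "action \<Rightarrow> nat" where
  "number_action (Write a b) = 4 * pair a b"
| "number_action (MoveL q) = 4 * q + 1"
| "number_action (MoveR q) = 4 * q + 2"
| "number_action (Query a b) = 4 * pair a b + 3"

definition number_quadruple :: "(nat \<times> nat) \<times> action \<Rightarrow> nat" where
  "number_quadruple z = pair (prod_encode (fst z)) (number_action (snd z))"

lemma action_of_number: "action_of (number_action a) = a"
proof -
  have "(4 * q + 1) div 4 = q" "(4 * q + 1) mod 4 = 1" "(4 * q + 2) div 4 = q" "(4 * q + 2) mod 4 = 2"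
    "(4 * q + 3) div 4 = q" "(4 * q + 3) mod 4 = 3" for q :: nat
    by presburger+
  then show ?thesis by (cases a) (simp_all add: action_of_def)
qed

lemma quadruple_of_number: "quadruple_of (number_quadruple z) = z"
  by (simp add: quadruple_of_def number_quadruple_def action_of_number)

definition number_program :: "program \<Rightarrow> nat" where
  "number_program P = list_encode (map number_quadruple P)"

lemma program_of_number [simp]: "program_of (number_program P) = P"
  by (simp add: program_of_def number_program_def quadruple_of_number o_def)

lemma number_program_Cons: "number_program (z # P) = Suc (pair (number_quadruple z) (number_program P))"
  by (simp add: number_program_def)

text \<open>
  The parameter is loaded into register 1 by a chain of increments that ends in state \<open>b - 1\<close>,
  the entry of \<open>P\<close>. Meanwhile only registers 0 and 1 are in use, so the increments need not
  know about symbols other than 0, 1, 2, 4, 5, and the chain does not depend on the number of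
  registers of \<open>P\<close>.
\<close>

abbreviation load_step :: "nat \<Rightarrow> program" where
  "load_step n \<equiv> rows [0, 1, 2, 4, 5] n (code (Inc 1) n)"

primrec load :: "nat \<Rightarrow> program \<Rightarrow> nat \<Rightarrow> program" where
  "load b P 0 = P"
| "load b P (Suc j) = load_step (b + 2 * j) @ load b P j"

text \<open>The three extra rows install the marker: from cell 0, which holds 0 or 1 according to
  the input, the head steps to the blank cell -1 and writes 2. The input block already has the form
  of register 0.\<close>

definition loaded :: "nat \<Rightarrow> program \<Rightarrow> nat \<Rightarrow> program" where
  "loaded b P k =
    ((0, 0), MoveL (b + 2 * k)) # ((0, 1), MoveL (b + 2 * k)) #
    ((b + 2 * k, 0), Write 2 (b + 2 * k - 1)) # load b P k"

text \<open>The ten rows of \<open>load_step n\<close> as explicit arithmetic, so that the closure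
  rules apply. Register 1 has track 2; adding its mark turns the symbol 0 into 4 and 1 into
  5.\<close>

definition number_load_step :: "nat \<Rightarrow> nat \<Rightarrow> nat" where
  "number_load_step n l =
    Suc (pair (pair (pair n 0) (4 * n + 1))
   (Suc (pair (pair (pair n 1) (4 * n + 1))
   (Suc (pair (pair (pair n 2) (4 * pair 2 (n - 1)))
   (Suc (pair (pair (pair n 4) (4 * n + 1))
   (Suc (pair (pair (pair n 5) (4 * n + 1))
   (Suc (pair (pair (pair (n + 1) 0) (4 * pair 4 n))
   (Suc (pair (pair (pair (n + 1) 1) (4 * pair 5 n))
   (Suc (pair (pair (pair (n + 1) 2) (4 * (n + 1) + 2))
   (Suc (pair (pair (pair (n + 1) 4) (4 * (n + 1) + 2))
   (Suc (pair (pair (pair (n + 1) 5) (4 * (n + 1) + 2)) l)))))))))))))))))))"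

lemma number_program_load_step:
  "number_program (load_step n @ P) = number_load_step n (number_program P)"
proof -
  have 1: "set_decode 1 = {0}" "set_decode (Suc 0) = {0}"
    using set_encode_inverse[of "{0}"] by simp_all
  have 2: "marked (Suc 0) 0 = False" "marked (Suc 0) (Suc 0) = False"
    "marked (Suc 0) 4 = True" "marked (Suc 0) 5 = True"
    by (simp_all add: marked_def track_def set_decode_def)
  have 3: "set_encode {2} = 4" "set_encode {2, 0} = 5" "track (Suc 0) = 2"
    by (simp_all add: set_encode_def track_def)
  show ?thesis
    by (simp add: number_load_step_def number_program_Cons number_quadruple_def home_def 1 2 3)
qed

text \<open>What is loaded is not \<open>k\<close> but \<open>pair (pair m b) k\<close>. This is the
  diagonal step of the recursion theorem: these three numbers determine the number of the resulting
  program.\<close>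

definition smn :: "nat \<Rightarrow> nat \<Rightarrow> nat \<Rightarrow> nat" where
  "smn m b k =
    Suc (pair (pair (pair 0 0) (4 * (b + 2 * pair (pair m b) k) + 1))
   (Suc (pair (pair (pair 0 1) (4 * (b + 2 * pair (pair m b) k) + 1))
   (Suc (pair (pair (pair (b + 2 * pair (pair m b) k) 0) (4 * pair 2 (b + 2 * pair (pair m b) k - 1)))
     (rec_nat m (\<lambda>j. number_load_step (b + 2 * j)) (pair (pair m b) k)))))))"

lemma smn_eq: "smn (number_program P) b k = number_program (loaded b P (pair (pair (number_program P) b) k))"
proof -
  have "rec_nat (number_program P) (\<lambda>j. number_load_step (b + 2 * j)) j = number_program (load b P j)" for j
    by (induction j) (simp_all add: number_program_load_step del: code.simps rows.simps One_nat_def)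
  then show ?thesis
    by (simp add: smn_def loaded_def number_program_Cons number_quadruple_def)
qed

lemma cmp_smn [cmp_intros]:
  assumes f: "cmp f" and g: "cmp g" and h: "cmp h"
  shows "cmp (\<lambda>x. smn (f x) (g x) (h x))"
  unfolding smn_def number_load_step_def
  by (intro cmp_intros cmp_rec f g h cmp_comp[OF f] cmp_comp[OF g])

lemma code_no_query: "a \<in> set (code c n) \<Longrightarrow> a x \<noteq> Query y z"
  by (induction c arbitrary: n) (auto simp: home_def split: if_splits)

lemma rows_no_query:
  "(\<And>f x. f \<in> set fs \<Longrightarrow> f x \<noteq> Query y z) \<Longrightarrow> (key, Query y z) \<notin> set (rows S n fs)"
proof (induction fs arbitrary: n)
  case (Cons f fs)
  have "f x \<noteq> Query y z" for x by (rule Cons.prems) simp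
  moreover have "(key, Query y z) \<notin> set (rows S (Suc n) fs)"
    by (rule Cons.IH) (use Cons.prems in simp)
  ultimately show ?case by (auto dest: sym)
qed simp

lemma rows_code_no_query: "(key, Query y z) \<notin> set (rows S n (code c k))"
  by (rule rows_no_query) (rule code_no_query)

lemma ordinary_loaded:
  assumes "\<And>key y z. (key, Query y z) \<notin> set P"
  shows "ordinary (number_program (loaded b P k))"
proof -
  have "(key, Query y z) \<notin> set (load b P k)" for key y z
    by (induction k) (simp_all add: assms rows_code_no_query del: code.simps rows.simps)
  then show ?thesis by (simp add: ordinary_def loaded_def)
qed

section \<open>Execution of loaded programs\<close>

lemma load_below: "q < b \<Longrightarrow> map_of (load b P k) (q, x) = map_of P (q, x)"
  by (induction k) (simp_all add: map_add_def map_of_rows del: code.simps rows.simps)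

lemma symbols_2_eq: "symbols 2 = {0, 1, 2, 4, 5}"
proof -
  have "{..<2} = {0, Suc 0}" by auto
  then have 1: "track ` {..<2} = {2, 0}"
    by (simp add: track_def insert_commute numeral_2_eq_2)
  have 2: "Pow {2, 0 :: nat} = {{}, {0}, {2}, {2, 0}}"
    unfolding Pow_insert Pow_empty by auto
  have 3: "set_encode {2} = 4" "set_encode {2, 0} = 5"
    by (simp_all add: set_encode_def)
  have "symbols 2 = insert 2 {set_encode {}, set_encode {0}, set_encode {2}, set_encode {2, 0}}"
    unfolding symbols_def 1 2 by (simp only: image_insert image_empty)
  also have "\<dots> = {0, 1, 2, 4, 5}"
    unfolding 3 by (simp add: insert_commute)
  finally show ?thesis .
qed

lemma load_has: "i < k \<Longrightarrow> has (load b P k) 2 (b + 2 * i) (code (Inc 1) (b + 2 * i))"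
proof (induction k)
  case (Suc k)
  have top: "map_of (load_step n) (n + r, x) = Some ((code (Inc 1) n ! r) x)"
    if "r < length (code (Inc 1) n)" "x \<in> symbols 2" for n r x
  proof -
    have "x \<in> set [0, 1, 2, 4, 5]" using that(2) unfolding symbols_2_eq by simp
    then show ?thesis using that(1) unfolding map_of_rows by simp
  qed
  have below: "map_of (load_step n) (q, x) = None" if "q < n" for n q x
    using that unfolding map_of_rows by simp
  show ?case
    unfolding has_def
  proof (intro allI impI ballI)
    fix r x assume r: "r < length (code (Inc 1) (b + 2 * i))" and x: "x \<in> symbols 2"
    show "map_of (load b P (Suc k)) (b + 2 * i + r, x) = Some ((code (Inc 1) (b + 2 * i) ! r) x)"
    proof (cases "i = k")
      case True
      then show ?thesis
        using top[OF r x] by (simp add: map_add_def del: code.simps rows.simps)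
    next
      case False
      then have i: "i < k" using Suc.prems by simp
      then have "b + 2 * i + r < b + 2 * k" using r by (simp add: length_code)
      then show ?thesis
        using Suc.IH[OF i, unfolded has_def, rule_format, OF r x] below[of "b + 2 * i + r" "b + 2 * k" x]
        by (simp add: map_add_def del: code.simps rows.simps)
    qed
  qed
qed simp

lemma has_loadedI:
  "has (load b P k) d n fs \<Longrightarrow> 0 < n \<Longrightarrow> n + length fs \<le> b + 2 * k \<Longrightarrow> has (loaded b P k) d n fs"
  by (auto simp: has_def loaded_def)

lemma load_run:
  assumes b: "0 < b" and j: "j \<le> k" and s: "supp 2 s"
  shows "reach (loaded b P k) u (b + 2 * j - 1, -1, tape_of s) (b - 1, -1, tape_of (s(1 := s 1 + j)))"
  using j s
proof (induction j arbitrary: s)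
  case 0
  then show ?case by simp
next
  case (Suc j)
  have "has (loaded b P k) 2 (b + 2 * j) (code (Inc 1) (b + 2 * j))"
    by (rule has_loadedI[OF load_has]) (use b Suc.prems in \<open>auto simp: length_code\<close>)
  from code_Inc_correct[OF Suc.prems(2) _ this]
  have "reach (loaded b P k) u (b + 2 * j + 1, -1, tape_of s) (b + 2 * j - 1, -1, tape_of (s(1 := Suc (s 1))))"
    by simp
  moreover have "reach (loaded b P k) u (b + 2 * j - 1, -1, tape_of (s(1 := Suc (s 1))))
     (b - 1, -1, tape_of ((s(1 := Suc (s 1)))(1 := (s(1 := Suc (s 1))) 1 + j)))"
    using Suc.prems by (intro Suc.IH supp_upd) auto
  ultimately show ?case by (simp add: fun_upd_def cong: if_cong)
qed

lemma tape_of_input: "(\<lambda>i. if 0 \<le> i \<and> i < int n then 1 else 0)(-1 := 2) = tape_of ((\<lambda>_. 0)(0 := n))"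
proof
  fix i :: int
  have "{r. nat i < ((\<lambda>_. 0)(0 := n)) r} = (if i < int n \<and> 0 < n then {0} else {})" if "0 \<le> i"
    using that by (auto split: if_splits)
  then show "((\<lambda>i. if 0 \<le> i \<and> i < int n then 1 else 0)(-1 := 2)) i = tape_of ((\<lambda>_. 0)(0 := n)) i"
    by (auto simp: tape_of_def track_def set_encode_def)
qed

text \<open>The symbol 1 means that a cell bears the mark of register 0 and no other, so the output
  is read off correctly because all other registers have been cleared.\<close>

lemma ones_tape: "ones (tape_of ((\<lambda>_. 0)(0 := n))) = n"
proof -
  have "{i. tape_of ((\<lambda>_. 0)(0 := n)) i = 1} = {0..<int n}"
    unfolding tape_of_input[symmetric] by auto
  then show ?thesis by (simp add: ones_def)
qed

lemma loaded_start:
  assumes "0 < b"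
  shows "reach (loaded b P k) u (initial n) (b + 2 * k - 1, -1, tape_of ((\<lambda>_. 0)(0 := n)))"
proof -
  have 1: "step (loaded b P k) u (initial n) =
      Some (b + 2 * k, -1, (\<lambda>i. if 0 \<le> i \<and> i < int n then 1 else 0))"
    using assms by (simp add: loaded_def initial_def)
  have 2: "step (loaded b P k) u (b + 2 * k, -1, (\<lambda>i. if 0 \<le> i \<and> i < int n then 1 else 0)) =
      Some (b + 2 * k - 1, -1, tape_of ((\<lambda>_. 0)(0 := n)))"
    using assms by (simp add: loaded_def tape_of_input)
  show ?thesis by (rule reach_step[OF 1], rule reach_step[OF 2]) simp
qed

lemma finite_symbols: "finite (symbols d)"
  by (simp add: symbols_def)

text \<open>
  The s-m-n theorem in the form of the recursion theorem: the program \<open>smn m b k\<close> knows, besides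
  its input and its parameter \<open>k\<close>, the numbers \<open>m\<close> and \<open>b\<close>, from which it can compute its own
  number and those of its siblings.
\<close>

theorem smn_recursion:
  assumes "cmp_on D f"
  shows "\<exists>m b. (\<forall>k. ordinary (smn m b k)) \<and>
    (\<forall>k n u. pair (pair (pair m b) k) n \<in> D \<longrightarrow>
      outp (smn m b k) u n (f (pair (pair (pair m b) k) n)))"
proof -
  from assms obtain C where C: "implements C D f" by (auto simp: cmp_on_def)
  define G where "G = Seq (pair_com 0) (C 0)"
  obtain d where d: "regs G \<subseteq> {..<d}" "2 \<le> d"
  proof -
    have "finite (insert 1 (regs G))" by (simp add: finite_regs)
    then obtain d where "insert 1 (regs G) \<subseteq> {..<d}" using finite_nat_bounded by blast
    then show ?thesis by (intro that[of d]) auto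
  qed
  define S where "S = sorted_list_of_set (symbols d)"
  \<comment> \<open>The code starts at state 2 because state 0 is the initial state and state 1, to
    which control leaves, must have no rows, so that the program halts there.\<close>
  define P where "P = rows S 2 (code G 2)"
  define b where "b = 2 + clen G"
  define m where "m = number_program P"
  have smn: "smn m b k = number_program (loaded b P (pair (pair m b) k))" for k
    by (simp add: smn_eq m_def)
  show ?thesis
  proof (intro exI conjI allI impI)
    show "ordinary (smn m b k)" for k
      unfolding smn P_def by (rule ordinary_loaded[OF rows_code_no_query])
    fix k n u
    assume D: "pair (pair (pair m b) k) n \<in> D"
    define K where "K = pair (pair m b) k"
    define y where "y = f (pair K n)"
    let ?P = "loaded b P K"
    let ?s = "(\<lambda>_. 0 :: nat)(0 :: nat := n)"
    have "0 < b" "supp 2 ?s" by (simp_all add: b_def supp_def)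
    from load_run[OF this(1) order_refl this(2), of P K u]
    have 1: "reach ?P u (b + 2 * K - 1, -1, tape_of ?s) (b - 1, -1, tape_of (?s(1 := K)))"
      by simp
    have "bs G (?s(1 := K)) ((\<lambda>_. 0)(0 := y))"
      unfolding G_def
      by (rule bs_eq[OF bs.Seq[OF bs_pair_com implementsD[OF C]]])
        (use D in \<open>auto simp: K_def y_def fun_eq_iff\<close>)
    moreover have "supp d (?s(1 := K))"
      using d(2) by (auto simp: supp_def)
    moreover have "has ?P d 2 (code G 2)"
    proof (rule has_loadedI)
      show "has (load b P K) d 2 (code G 2)"
        by (auto simp: has_def load_below b_def length_code P_def S_def map_of_rows finite_symbols)
    qed (auto simp: b_def length_code)
    ultimately have 2: "reach ?P u (b - 1, -1, tape_of (?s(1 := K))) (1, -1, tape_of ((\<lambda>_. 0)(0 := y)))"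
      using code_correct[of G _ _ d ?P 2 u] d(1) by (simp add: b_def)
    have "map_of ?P (1, x) = None" for x
      using load_below[of 1 b P K x] by (simp add: loaded_def b_def P_def map_of_rows)
    then have 3: "step ?P u (1, -1, tape_of ((\<lambda>_. 0)(0 := y))) = None"
      by simp
    have "computes ?P u n y"
      unfolding computes_def
      using rtranclp_trans[OF loaded_start rtranclp_trans[OF 1 2]] 3 ones_tape[of y]
      by (metis b_def add_pos_nonneg zero_less_numeral zero_le)
    then show "outp (smn m b k) u n (f (pair (pair (pair m b) k) n))"
      by (simp add: outp_def smn K_def y_def)
  qed
qed

lemma computable2I:
  assumes "cmp (\<lambda>z. f (pfst z) (psnd z))"
  shows "computable2 f"
proof -
  have "cmp (\<lambda>z. (\<lambda>z. f (pfst z) (psnd z)) (psnd z))"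
    by (intro cmp_comp[OF assms] cmp_intros)
  from smn_recursion[OF this] obtain m b where "\<And>k. ordinary (smn m b k)"
    "\<And>k n u. outp (smn m b k) u n (f (pfst n) (psnd n))"
    by auto
  then have "out (smn m b 0) (pair x y) (f x y)" for x y
    unfolding out_def by (metis pfst_pair psnd_pair)
  then show ?thesis unfolding computable2_def by blast
qed

section \<open>Truth and the evaluator\<close>

definition bound :: "nat \<Rightarrow> nat \<Rightarrow> nat" where
  "bound e k = (e + 2) ^ (2 ^ k)"

lemma bound_mono: "k \<le> l \<Longrightarrow> bound e k \<le> bound e l"
  unfolding bound_def by (intro power_increasing) auto

lemma bound_ge_2: "2 \<le> bound e k"
proof -
  have "(e + 2) ^ 1 \<le> bound e k" unfolding bound_def by (intro power_increasing) auto
  then show ?thesis by simp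
qed

text \<open>The origin of the double exponent: raising \<open>k\<close> by 1 squares the bound,
  which pays for one product, and also for one sum, since the base is at least 2.\<close>

lemma bound_step:
  assumes "x \<le> bound e k" "y \<le> bound e k" "k < l"
  shows "x + y \<le> bound e l" "x * y \<le> bound e l"
proof -
  have "bound e k * bound e k = bound e (Suc k)"
    by (simp add: bound_def mult_2 power_add)
  also have "\<dots> \<le> bound e l" using assms(3) by (intro bound_mono) simp
  finally have sq: "bound e k * bound e k \<le> bound e l" .
  have "x + y \<le> 2 * bound e k" using assms by simp
  also have "\<dots> \<le> bound e k * bound e k" using bound_ge_2 by simp
  finally show "x + y \<le> bound e l" using sq by simp
  show "x * y \<le> bound e l" using mult_le_mono[OF assms(1,2)] sq by simp
qed

lemma le_pair1: "a \<le> x \<Longrightarrow> a \<le> pair x y"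
  using le_prod_encode_1 le_trans by blast

lemma le_pair2: "a \<le> y \<Longrightarrow> a \<le> pair x y"
  using le_prod_encode_2 le_trans by blast

lemma less_pair2: "0 < x \<Longrightarrow> y < pair x y"
  using psnd_less[of "pair x y"] by simp

lemma tval_le_bound: "tval (lookup e) t \<le> bound e (trm_number t)"
proof (induction t)
  case (Var i)
  have "e \<le> (e + 2) ^ 1" by simp
  also have "\<dots> \<le> bound e (trm_number (Var i))" unfolding bound_def by (intro power_increasing) auto
  finally show ?case using lookup_le[of e i] by simp
next
  case (Succ t)
  then show ?case
    using bound_step(1)[of _ e "trm_number t" 1 "trm_number (Succ t)"] bound_ge_2[of e "trm_number t"]
      less_pair2[of 2 "trm_number t"] by simp
next
  case (Plus s t)
  let ?k = "pair (trm_number s) (trm_number t)"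
  have "tval (lookup e) s \<le> bound e ?k" "tval (lookup e) t \<le> bound e ?k"
    using Plus bound_mono[OF le_prod_encode_1] bound_mono[OF le_prod_encode_2] le_trans by blast+
  from bound_step(1)[OF this, of "trm_number (Plus s t)"] show ?case
    by (simp add: less_pair2)
next
  case (Times s t)
  let ?k = "pair (trm_number s) (trm_number t)"
  have "tval (lookup e) s \<le> bound e ?k" "tval (lookup e) t \<le> bound e ?k"
    using Times bound_mono[OF le_prod_encode_1] bound_mono[OF le_prod_encode_2] le_trans by blast+
  from bound_step(2)[OF this, of "trm_number (Times s t)"] show ?case
    by (simp add: less_pair2)
qed simp

lemma pair_mono: "a \<le> a' \<Longrightarrow> b \<le> b' \<Longrightarrow> pair a b \<le> pair a' b'"
  unfolding prod_encode_def triangle_def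
  by (auto intro!: add_mono div_le_mono mult_le_mono)

text \<open>A bounded quantifier contains its bound only in lifted form, while the range must exceed
  the value of the bound itself; the number of the formula therefore has to dominate that of the
  unlifted term.\<close>

lemma trm_number_lift: "trm_number t \<le> trm_number (lift_trm t)"
  by (induction t) (auto intro!: pair_mono)

lemma tval_lift: "tval (case_nat n \<sigma>) (lift_trm t) = tval \<sigma> t"
  by (induction t) auto

lemma sat_Less: "sat \<sigma> (Less s t) \<longleftrightarrow> tval \<sigma> s < tval \<sigma> t"
  by (simp add: Less_def tval_lift less_iff_Suc_add) metis

lemma range_size_ge:
  assumes "m < tval (lookup e) t" "trm_number t \<le> c"
  shows "m < range_size N e c"
  using assms(1) tval_le_bound[of e t] bound_mono[OF assms(2), of e]
  unfolding range_size_def bound_def by linarith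

lemma eval_fm_number:
  "eval_fm N e (fm_number Bot) \<longleftrightarrow> False"
  "eval_fm N e (fm_number (Eq s t)) \<longleftrightarrow> tval (lookup e) s = tval (lookup e) t"
  "eval_fm N e (fm_number (And \<phi> \<psi>)) \<longleftrightarrow> eval_fm N e (fm_number \<phi>) \<and> eval_fm N e (fm_number \<psi>)"
  "eval_fm N e (fm_number (Or \<phi> \<psi>)) \<longleftrightarrow> eval_fm N e (fm_number \<phi>) \<or> eval_fm N e (fm_number \<psi>)"
  "eval_fm N e (fm_number (Imp \<phi> \<psi>)) \<longleftrightarrow> (eval_fm N e (fm_number \<phi>) \<longrightarrow> eval_fm N e (fm_number \<psi>))"
  "eval_fm N e (fm_number (Ex \<phi>)) \<longleftrightarrow>
    (\<exists>m<range_size N e (fm_number (Ex \<phi>)). eval_fm N (pair m e) (fm_number \<phi>))"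
  "eval_fm N e (fm_number (All \<phi>)) \<longleftrightarrow>
    (\<forall>m<range_size N e (fm_number (All \<phi>)). eval_fm N (pair m e) (fm_number \<phi>))"
  using eval_fm.simps[of N e "fm_number Bot"] eval_fm.simps[of N e "fm_number (Eq s t)"]
    eval_fm.simps[of N e "fm_number (And \<phi> \<psi>)"] eval_fm.simps[of N e "fm_number (Or \<phi> \<psi>)"]
    eval_fm.simps[of N e "fm_number (Imp \<phi> \<psi>)"] eval_fm.simps[of N e "fm_number (Ex \<phi>)"]
    eval_fm.simps[of N e "fm_number (All \<phi>)"]
  by (simp_all add: eval_trm)

declare fm_number.simps [simp del]

section \<open>Exactness of the evaluator\<close>

definition exact :: "fm \<Rightarrow> bool" where
  "exact \<phi> \<longleftrightarrow> (\<forall>N e. eval_fm N e (fm_number \<phi>) \<longleftrightarrow> sat (lookup e) \<phi>)"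

text \<open>A positive verdict is right for every \<open>N\<close>, but truth is recognised only for
  large \<open>N\<close>. Asking for all large \<open>N\<close>, not just for one, lets the finitely
  many instances of a bounded universal quantifier share an \<open>N\<close>.\<close>

definition semi_exact :: "fm \<Rightarrow> bool" where
  "semi_exact \<phi> \<longleftrightarrow> (\<forall>e.
    (\<forall>N. eval_fm N e (fm_number \<phi>) \<longrightarrow> sat (lookup e) \<phi>) \<and>
    (sat (lookup e) \<phi> \<longrightarrow> (\<forall>\<^sub>F N in sequentially. eval_fm N e (fm_number \<phi>))))"

lemma exact_imp_semi_exact: "exact \<phi> \<Longrightarrow> semi_exact \<phi>"
  unfolding exact_def semi_exact_def by simp

lemma exact_Ex:
  assumes "exact \<phi>"
    and "\<And>N e m. sat (lookup (pair m e)) \<phi> \<Longrightarrow> m < range_size N e (fm_number (Ex \<phi>))"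
  shows "exact (Ex \<phi>)"
  unfolding exact_def
proof (intro allI)
  fix N e
  have "eval_fm N (pair m e) (fm_number \<phi>) \<longleftrightarrow> sat (lookup (pair m e)) \<phi>" for m
    using assms(1) unfolding exact_def by blast
  then show "eval_fm N e (fm_number (Ex \<phi>)) \<longleftrightarrow> sat (lookup e) (Ex \<phi>)"
    using assms(2)[of _ e N] unfolding eval_fm_number(6,7) sat.simps(6,7) lookup_pair[symmetric] by metis
qed

lemma exact_All:
  assumes "exact \<phi>"
    and "\<And>N e m. \<not> sat (lookup (pair m e)) \<phi> \<Longrightarrow> m < range_size N e (fm_number (All \<phi>))"
  shows "exact (All \<phi>)"
  unfolding exact_def
proof (intro allI)
  fix N e
  have "eval_fm N (pair m e) (fm_number \<phi>) \<longleftrightarrow> sat (lookup (pair m e)) \<phi>" for m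
    using assms(1) unfolding exact_def by blast
  then show "eval_fm N e (fm_number (All \<phi>)) \<longleftrightarrow> sat (lookup e) (All \<phi>)"
    using assms(2)[of _ e N] unfolding eval_fm_number(6,7) sat.simps(6,7) lookup_pair[symmetric] by metis
qed

text \<open>The order is itself defined by an unbounded quantifier, but its witness lies below the
  value of \<open>t\<close> and hence in the range.\<close>

lemma exact_Less: "exact (Less s t)"
  unfolding Less_def
proof (rule exact_Ex)
  show "exact (Eq (Plus (lift_trm s) (Succ (Var 0))) (lift_trm t))"
    unfolding exact_def eval_fm_number by simp
  fix N e m
  assume "sat (lookup (pair m e)) (Eq (Plus (lift_trm s) (Succ (Var 0))) (lift_trm t))"
  then have "m < tval (lookup e) t"
    by (simp add: lookup_pair tval_lift)
  then show "m < range_size N e (fm_number (Ex (Eq (Plus (lift_trm s) (Succ (Var 0))) (lift_trm t))))"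
    by (rule range_size_ge) (simp add: fm_number.simps, intro le_pair2 trm_number_lift)
qed

lemma trm_number_le_Less: "trm_number t \<le> fm_number (Less s (lift_trm t))"
  unfolding Less_def fm_number.simps
  by (intro le_pair2 order.trans[OF trm_number_lift trm_number_lift])

lemma range_size_BEx:
  "m < tval (lookup e) t \<Longrightarrow> m < range_size N e (fm_number (BEx t \<phi>))"
  unfolding BEx_def fm_number.simps
  by (erule range_size_ge) (rule le_pair2 le_pair1 trm_number_le_Less)+

lemma range_size_BAll:
  "m < tval (lookup e) t \<Longrightarrow> m < range_size N e (fm_number (BAll t \<phi>))"
  unfolding BAll_def fm_number.simps
  by (erule range_size_ge) (rule le_pair2 le_pair1 trm_number_le_Less)+

lemma sat_bound: "sat (lookup (pair m e)) (Less (Var 0) (lift_trm t)) \<longleftrightarrow> m < tval (lookup e) t"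
  by (simp add: sat_Less lookup_pair tval_lift)

text \<open>Beyond the bound the body of \<open>BEx\<close> is false and that of \<open>BAll\<close>
  is true, so cutting the quantifiers off at the range loses nothing.\<close>

lemma exact_Delta0: "Delta0 \<phi> \<Longrightarrow> exact \<phi>"
proof (induction rule: Delta0.induct)
  case (6 \<phi> t)
  then have "exact (And (Less (Var 0) (lift_trm t)) \<phi>)"
    using exact_Less by (simp add: exact_def eval_fm_number)
  then show ?case
    using range_size_BEx unfolding BEx_def by (intro exact_Ex) (auto simp: sat_bound)
next
  case (7 \<phi> t)
  then have "exact (Imp (Less (Var 0) (lift_trm t)) \<phi>)"
    using exact_Less by (simp add: exact_def eval_fm_number)
  then show ?case
    using range_size_BAll unfolding BAll_def by (intro exact_All) (auto simp: sat_bound)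
qed (simp_all add: exact_def eval_fm_number)

lemma semi_exact_Ex:
  assumes "semi_exact \<phi>"
  shows "semi_exact (Ex \<phi>)"
  unfolding semi_exact_def
proof (intro allI conjI impI)
  fix e N assume "eval_fm N e (fm_number (Ex \<phi>))"
  then show "sat (lookup e) (Ex \<phi>)"
    using assms unfolding semi_exact_def eval_fm_number sat.simps lookup_pair[symmetric] by blast
next
  fix e assume "sat (lookup e) (Ex \<phi>)"
  then obtain m where "sat (lookup (pair m e)) \<phi>" by (auto simp: lookup_pair)
  then have "\<forall>\<^sub>F N in sequentially. eval_fm N (pair m e) (fm_number \<phi>)"
    using assms unfolding semi_exact_def by blast
  moreover have "\<forall>\<^sub>F N in sequentially. m < N" by (rule eventually_gt_at_top)
  ultimately show "\<forall>\<^sub>F N in sequentially. eval_fm N e (fm_number (Ex \<phi>))"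
    unfolding eval_fm_number by eventually_elim (auto simp: range_size_def intro: trans_less_add1)
qed

lemma semi_exact_And: "exact \<phi> \<Longrightarrow> semi_exact \<psi> \<Longrightarrow> semi_exact (And \<phi> \<psi>)"
  by (auto simp: exact_def semi_exact_def eval_fm_number)

lemma semi_exact_BAll:
  assumes "semi_exact \<phi>"
  shows "semi_exact (BAll t \<phi>)"
  unfolding semi_exact_def
proof (intro allI conjI impI)
  fix e N assume eval: "eval_fm N e (fm_number (BAll t \<phi>))"
  have "sat (lookup (pair m e)) \<phi>" if "m < tval (lookup e) t" for m
    using eval range_size_BAll[OF that, of N \<phi>] that assms exact_Less
    unfolding BAll_def eval_fm_number by (auto simp: semi_exact_def exact_def sat_bound)
  then show "sat (lookup e) (BAll t \<phi>)"
    unfolding BAll_def using sat_bound by (auto simp: lookup_pair)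
next
  fix e assume sat: "sat (lookup e) (BAll t \<phi>)"
  have "\<forall>\<^sub>F N in sequentially. eval_fm N (pair m e) (fm_number \<phi>)" if "m < tval (lookup e) t" for m
    using sat that assms sat_bound unfolding BAll_def by (auto simp: semi_exact_def lookup_pair)
  then have "\<forall>\<^sub>F N in sequentially. \<forall>m\<in>{..<tval (lookup e) t}. eval_fm N (pair m e) (fm_number \<phi>)"
    by (intro eventually_ball_finite) auto
  then show "\<forall>\<^sub>F N in sequentially. eval_fm N e (fm_number (BAll t \<phi>))"
    by eventually_elim (use exact_Less in \<open>auto simp: BAll_def eval_fm_number exact_def sat_bound\<close>)
qed

lemma semi_exact_pretty: "pretty_Sigma1_fm \<phi> \<Longrightarrow> semi_exact \<phi>"
proof (induction rule: pretty_Sigma1_fm.induct)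
  case (1 \<phi>)
  then show ?case by (intro exact_imp_semi_exact exact_Delta0)
next
  case (2 \<phi>)
  show ?case by (rule semi_exact_Ex) fact
next
  case (3 \<phi> t)
  then show ?case unfolding BEx_def by (intro semi_exact_Ex semi_exact_And exact_Less)
next
  case (4 \<phi> t)
  then show ?case by (intro semi_exact_BAll)
qed

section \<open>Soundness\<close>

lemma measure_coin_UNIV: "measure coin_measure UNIV = 1"
proof -
  interpret prob_space coin_measure
    unfolding coin_measure_def by (intro prob_space_PiM measure_pmf.prob_space_axioms)
  have "space coin_measure = UNIV"
    by (simp add: coin_measure_def space_PiM PiE_UNIV_domain)
  then show ?thesis using prob_space by simp
qed

text \<open>Without such an oracle the measured set would be empty and have measure 0.\<close>

lemma mrealises_imp_orealises: "mrealises_at \<sigma> p \<phi> \<Longrightarrow> \<exists>u. orealises_at \<sigma> p u \<phi>"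
  by (rule ccontr) auto

lemma orealises_imp_mrealises: "(\<And>u. orealises_at \<sigma> p u \<phi>) \<Longrightarrow> mrealises_at \<sigma> p \<phi>"
  by (auto simp: measure_coin_UNIV intro: exI[of _ 1])

declare mrealises_at.simps [simp del]

text \<open>Restricted to coded assignments, because soundness of implications relies on canonical
  realisers, which receive the assignment as a number.\<close>

definition sound :: "fm \<Rightarrow> bool" where
  "sound \<phi> \<longleftrightarrow> (\<forall>e p. (realises_at (lookup e) p \<phi> \<longrightarrow> sat (lookup e) \<phi>) \<and>
    (\<forall>u. orealises_at (lookup e) p u \<phi> \<longrightarrow> sat (lookup e) \<phi>))"

lemma sound_Bot: "sound Bot" and sound_Eq: "sound (Eq s t)"
  by (simp_all add: sound_def)

lemma sound_And: "sound \<phi> \<Longrightarrow> sound \<psi> \<Longrightarrow> sound (And \<phi> \<psi>)"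
  unfolding sound_def realises_at.simps orealises_at.simps sat.simps by blast

lemma sound_Or: "sound \<phi> \<Longrightarrow> sound \<psi> \<Longrightarrow> sound (Or \<phi> \<psi>)"
  unfolding sound_def realises_at.simps orealises_at.simps sat.simps by blast

lemma sound_Ex: "sound \<phi> \<Longrightarrow> sound (Ex \<phi>)"
  by (auto simp: sound_def simp flip: lookup_pair)

lemma sound_All: "sound \<phi> \<Longrightarrow> sound (All \<phi>)"
  unfolding sound_def by (simp flip: lookup_pair) blast

lemma sound_Less: "sound (Less s t)"
  unfolding Less_def by (intro sound_Ex sound_Eq)

section \<open>Canonical realisers\<close>

text \<open>All that the realisability argument has to know of the programs. In
  \<open>out_Ex\<close> the witness \<open>m\<close> is fixed before the oracle \<open>u\<close>,
  and it may differ from \<open>n\<close>, because the search finds a witness of its own.\<close>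

locale canonical_realiser =
  fixes R :: "nat \<Rightarrow> nat \<Rightarrow> nat"
  assumes ordinary_R: "ordinary (R c e)"
    and out_And: "outp (R (fm_number (And \<phi> \<psi>)) e) u 0 (R (fm_number \<phi>) e)"
      "outp (R (fm_number (And \<phi> \<psi>)) e) u 1 (R (fm_number \<psi>) e)"
    and out_Or_left: "eval_fm 0 e (fm_number \<phi>) \<Longrightarrow>
      outp (R (fm_number (Or \<phi> \<psi>)) e) u 0 0 \<and>
      outp (R (fm_number (Or \<phi> \<psi>)) e) u 1 (R (fm_number \<phi>) e)"
    and out_Or_right: "\<not> eval_fm 0 e (fm_number \<phi>) \<Longrightarrow>
      outp (R (fm_number (Or \<phi> \<psi>)) e) u 0 1 \<and>
      outp (R (fm_number (Or \<phi> \<psi>)) e) u 1 (R (fm_number \<psi>) e)"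
    and out_Imp: "outp (R (fm_number (Imp \<phi> \<psi>)) e) u n (R (fm_number \<psi>) e)"
    and out_All: "outp (R (fm_number (All \<phi>)) e) u n (R (fm_number \<phi>) (pair n e))"
    and out_Ex: "eval_fm N (pair n e) (fm_number \<phi>) \<Longrightarrow>
      \<exists>N m. eval_fm N (pair m e) (fm_number \<phi>) \<and>
        (\<forall>u. outp (R (fm_number (Ex \<phi>)) e) u 0 (R (fm_number \<phi>) (pair m e)) \<and>
             outp (R (fm_number (Ex \<phi>)) e) u 1 m)"
begin

definition complete :: "fm \<Rightarrow> bool" where
  "complete \<phi> \<longleftrightarrow> (\<forall>e. sat (lookup e) \<phi> \<longrightarrow>
    realises_at (lookup e) (R (fm_number \<phi>) e) \<phi> \<and>
    (\<forall>u. orealises_at (lookup e) (R (fm_number \<phi>) e) u \<phi>))"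

lemma outI: "(\<And>u. outp (R c e) u n m) \<Longrightarrow> out (R c e) n m"
  by (simp add: out_def ordinary_R)

lemma complete_Bot: "complete Bot" and complete_Eq: "complete (Eq s t)"
  by (simp_all add: complete_def ordinary_R)

lemma complete_And: "complete \<phi> \<Longrightarrow> complete \<psi> \<Longrightarrow> complete (And \<phi> \<psi>)"
  unfolding complete_def using out_And
  by (auto intro!: outI exI conjI)

lemma complete_Or:
  assumes "exact \<phi>" "complete \<phi>" "complete \<psi>"
  shows "complete (Or \<phi> \<psi>)"
  unfolding complete_def
proof (intro allI impI)
  fix e assume sat: "sat (lookup e) (Or \<phi> \<psi>)"
  let ?R = "R (fm_number (Or \<phi> \<psi>)) e"
  show "realises_at (lookup e) ?R (Or \<phi> \<psi>) \<and> (\<forall>u. orealises_at (lookup e) ?R u (Or \<phi> \<psi>))"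
  proof (cases "sat (lookup e) \<phi>")
    case True
    then have eval: "eval_fm 0 e (fm_number \<phi>)" using assms(1) by (simp add: exact_def)
    note o = out_Or_left[OF eval, of \<psi>]
    have "out ?R 0 0" "out ?R 1 (R (fm_number \<phi>) e)"
      using o by (blast intro: outI)+
    then show ?thesis
      using o True assms(2) unfolding complete_def realises_at.simps orealises_at.simps by blast
  next
    case False
    then have eval: "\<not> eval_fm 0 e (fm_number \<phi>)" using assms(1) by (simp add: exact_def)
    note o = out_Or_right[OF eval, of \<psi>]
    have "out ?R 0 1" "out ?R 1 (R (fm_number \<psi>) e)"
      using o by (blast intro: outI)+
    then show ?thesis
      using o sat False assms(3) unfolding complete_def realises_at.simps orealises_at.simps sat.simps by blast
  qed
qed

text \<open>Any realiser of the antecedent shows it to be true; then the consequent is true, and its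
  canonical realiser is a correct answer whatever the argument was.\<close>

lemma complete_Imp:
  assumes "sound \<phi>" "complete \<psi>"
  shows "complete (Imp \<phi> \<psi>)"
  unfolding complete_def
proof (intro allI impI conjI)
  fix e assume sat: "sat (lookup e) (Imp \<phi> \<psi>)"
  let ?R = "R (fm_number (Imp \<phi> \<psi>)) e"
  have out: "out ?R s (R (fm_number \<psi>) e)" for s
    using out_Imp by (blast intro: outI)
  show "realises_at (lookup e) ?R (Imp \<phi> \<psi>)"
    using sat out assms ordinary_R
    unfolding sound_def complete_def realises_at.simps sat.simps by blast
  fix u
  have "mrealises_at (lookup e) (R (fm_number \<psi>) e) \<psi>" if "mrealises_at (lookup e) s \<phi>" for s
    using mrealises_imp_orealises[OF that] sat assms
    unfolding sound_def complete_def sat.simps by (blast intro: orealises_imp_mrealises)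
  then show "orealises_at (lookup e) ?R u (Imp \<phi> \<psi>)"
    using out_Imp unfolding orealises_at.simps by blast
qed

text \<open>A true antecedent has to be turned into an argument for the given program; its canonical
  realiser is one.\<close>

lemma sound_Imp:
  assumes "complete \<phi>" "sound \<psi>"
  shows "sound (Imp \<phi> \<psi>)"
  unfolding sound_def
proof (intro allI impI conjI)
  fix e p assume "realises_at (lookup e) p (Imp \<phi> \<psi>)"
  then show "sat (lookup e) (Imp \<phi> \<psi>)"
    using assms unfolding complete_def sound_def realises_at.simps sat.simps by blast
next
  fix e p u assume p: "orealises_at (lookup e) p u (Imp \<phi> \<psi>)"
  show "sat (lookup e) (Imp \<phi> \<psi>)"
    unfolding sat.simps
  proof
    assume "sat (lookup e) \<phi>"
    then have "mrealises_at (lookup e) (R (fm_number \<phi>) e) \<phi>"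
      using assms(1) unfolding complete_def by (blast intro: orealises_imp_mrealises)
    with p obtain a where "mrealises_at (lookup e) a \<psi>"
      unfolding orealises_at.simps by blast
    then show "sat (lookup e) \<psi>"
      using mrealises_imp_orealises assms(2) unfolding sound_def by blast
  qed
qed

lemma complete_All: "complete \<phi> \<Longrightarrow> complete (All \<phi>)"
  unfolding complete_def realises_at.simps orealises_at.simps sat.simps lookup_pair[symmetric]
  using out_All by (blast intro: outI)

text \<open>Truth ensures that the search succeeds for some range; whatever pair it then finds, a
  positive verdict guarantees a true instance.\<close>

lemma complete_Ex:
  assumes "semi_exact \<phi>" "complete \<phi>"
  shows "complete (Ex \<phi>)"
  unfolding complete_def
proof (intro allI impI)
  fix e assume "sat (lookup e) (Ex \<phi>)"
  then obtain n where "sat (lookup (pair n e)) \<phi>" by (auto simp: lookup_pair)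
  then have "\<forall>\<^sub>F N in sequentially. eval_fm N (pair n e) (fm_number \<phi>)"
    using assms(1) unfolding semi_exact_def by blast
  then obtain N where "eval_fm N (pair n e) (fm_number \<phi>)"
    by (auto dest: eventually_happens)
  from out_Ex[OF this] obtain N m where eval: "eval_fm N (pair m e) (fm_number \<phi>)"
    and out: "\<And>u. outp (R (fm_number (Ex \<phi>)) e) u 0 (R (fm_number \<phi>) (pair m e))"
      "\<And>u. outp (R (fm_number (Ex \<phi>)) e) u 1 m" by blast
  from eval have "sat (lookup (pair m e)) \<phi>"
    using assms(1) unfolding semi_exact_def by blast
  then show "realises_at (lookup e) (R (fm_number (Ex \<phi>)) e) (Ex \<phi>) \<and>
      (\<forall>u. orealises_at (lookup e) (R (fm_number (Ex \<phi>)) e) u (Ex \<phi>))"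
    using out[THEN outI] out assms(2)
    unfolding complete_def realises_at.simps orealises_at.simps lookup_pair[symmetric] by blast
qed

lemma complete_Less: "complete (Less s t)"
  unfolding Less_def
  by (intro complete_Ex complete_Eq exact_imp_semi_exact exact_Delta0 Delta0.intros)

section \<open>Adequacy for the three classes of formulas\<close>

lemma Delta0_adequate: "Delta0 \<phi> \<Longrightarrow> sound \<phi> \<and> complete \<phi>"
proof (induction rule: Delta0.induct)
  case (6 \<phi> t)
  then have "semi_exact (And (Less (Var 0) (lift_trm t)) \<phi>)"
    by (intro semi_exact_And exact_Less exact_imp_semi_exact exact_Delta0)
  with 6 show ?case
    unfolding BEx_def by (simp add: sound_Ex sound_And sound_Less complete_Ex complete_And complete_Less)
next
  case (7 \<phi> t)
  then show ?case
    unfolding BAll_def by (simp add: sound_All sound_Imp sound_Less complete_All complete_Imp complete_Less)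
qed (simp_all add: sound_Bot sound_Eq sound_And sound_Or sound_Imp
  complete_Bot complete_Eq complete_And complete_Or complete_Imp exact_Delta0)

lemma pretty_Sigma1_adequate: "pretty_Sigma1_fm \<phi> \<Longrightarrow> sound \<phi> \<and> complete \<phi>"
proof (induction rule: pretty_Sigma1_fm.induct)
  case (1 \<phi>)
  then show ?case by (rule Delta0_adequate)
next
  case (2 \<phi>)
  then show ?case by (simp add: sound_Ex complete_Ex semi_exact_pretty)
next
  case (3 \<phi> t)
  then have "semi_exact (And (Less (Var 0) (lift_trm t)) \<phi>)"
    by (intro semi_exact_And exact_Less semi_exact_pretty)
  with 3 show ?case
    unfolding BEx_def by (simp add: sound_Ex sound_And sound_Less complete_Ex complete_And complete_Less)
next
  case (4 \<phi> t)
  then show ?case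
    unfolding BAll_def by (simp add: sound_All sound_Imp sound_Less complete_All complete_Imp complete_Less)
qed

lemma universal_Pi1_adequate: "universal_Pi1_fm \<phi> \<Longrightarrow> sound \<phi> \<and> complete \<phi>"
  by (induction rule: universal_Pi1_fm.induct) (simp_all add: Delta0_adequate sound_All complete_All)

lemma adequate:
  assumes "sound \<phi> \<and> complete \<phi>"
  shows "realises p \<phi> \<Longrightarrow> mu_realises_ge (R (fm_number \<phi>) 0) \<phi> 1"
    and "mu_realises p \<phi> \<Longrightarrow> realises (R (fm_number \<phi>) 0) \<phi>"
    and "true_in_N \<phi> \<longleftrightarrow> (\<exists>p. mu_realises p \<phi>)"
proof -
  have real: "true_in_N \<phi>" if "realises p \<phi>" for p
    using assms that unfolding sound_def realises_def true_in_N_def lookup_0[symmetric] by blast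
  have mu: "true_in_N \<phi>" if "mu_realises p \<phi>" for p
  proof -
    have "\<exists>u. orealises_at (\<lambda>_. 0) p u \<phi>"
      using that by (intro mrealises_imp_orealises)
        (simp add: mrealises_at.simps mu_realises_def mu_realises_ge_def C_set_def)
    then show ?thesis
      using assms unfolding sound_def true_in_N_def lookup_0[symmetric] by blast
  qed
  have canon: "realises (R (fm_number \<phi>) 0) \<phi>" "mu_realises_ge (R (fm_number \<phi>) 0) \<phi> 1" if "true_in_N \<phi>"
    using assms that
    unfolding complete_def realises_def true_in_N_def lookup_0[symmetric] mu_realises_ge_def C_set_def
    by (simp_all add: measure_coin_UNIV)
  show "realises p \<phi> \<Longrightarrow> mu_realises_ge (R (fm_number \<phi>) 0) \<phi> 1"
    and "mu_realises p \<phi> \<Longrightarrow> realises (R (fm_number \<phi>) 0) \<phi>"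
    using real mu canon by blast+
  have "mu_realises (R (fm_number \<phi>) 0) \<phi>" if "true_in_N \<phi>"
    using canon(2)[OF that] unfolding mu_realises_def by (intro exI[of _ 1]) simp
  with mu show "true_in_N \<phi> \<longleftrightarrow> (\<exists>p. mu_realises p \<phi>)" by blast
qed

end

section \<open>Existence of a computable canonical realiser\<close>

definition reply :: "nat \<Rightarrow> nat \<Rightarrow> nat \<Rightarrow> nat \<Rightarrow> nat \<Rightarrow> nat \<Rightarrow> nat" where
  "reply m b c e n y =
    (if pfst c = 2 then smn m b (pair (if n = 0 then pfst (psnd c) else psnd (psnd c)) e)
     else if pfst c = 3 then
       if n = 0 then if eval_fm 0 e (pfst (psnd c)) then 0 else 1
       else smn m b (pair (if eval_fm 0 e (pfst (psnd c)) then pfst (psnd c) else psnd (psnd c)) e)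
     else if pfst c = 4 then smn m b (pair (psnd (psnd c)) e)
     else if pfst c = 5 then
       if n = 0 then smn m b (pair (psnd c) (pair (psnd y) e)) else psnd y
     else smn m b (pair (psnd c) (pair n e)))"

text \<open>The number \<open>y\<close> codes a range parameter together with a candidate. The
  condition is vacuous for other tags, so one search, ending at once there, serves all
  formulas.\<close>

definition witness :: "nat \<Rightarrow> nat \<Rightarrow> nat \<Rightarrow> bool" where
  "witness c e y \<longleftrightarrow> pfst c = 5 \<longrightarrow> eval_fm (pfst y) (pair (psnd y) e) (psnd c)"

lemma canonical_realiser_exists:
  obtains R where "canonical_realiser R" "cmp (\<lambda>z. R (pfst z) (psnd z))"
proof -
  \<comment> \<open>Here \<open>z\<close> is \<open>pair (pair (pair m b) (pair c e)) n\<close>: the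
    loaded parameter, followed by the input. Through \<open>smn m b\<close> the reply names the
    realisers of subformulas.\<close>
  define wit where "wit = (\<lambda>z. witness (pfst (psnd (pfst z))) (psnd (psnd (pfst z))))"
  define ans where "ans = (\<lambda>z y. reply (pfst (pfst (pfst z))) (psnd (pfst (pfst z)))
    (pfst (psnd (pfst z))) (psnd (psnd (pfst z))) (psnd z) y)"
  have "decidable (\<lambda>z. wit (pfst z) (psnd z))"
    unfolding wit_def witness_def imp_conv_disj by (intro cmp_intros)
  then have "cmp_on {z. \<exists>y. wit z y} (\<lambda>z. LEAST y. wit z y)"
    by (rule cmp_on_Least)
  then have "cmp_on {z. \<exists>y. wit z y} (\<lambda>z. pair z (LEAST y. wit z y))"
    using cmp_on_subset[OF cmp_id subset_UNIV] by (rule cmp_on_pair[rotated])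
  moreover have "cmp (\<lambda>z. ans (pfst z) (psnd z))"
    unfolding ans_def reply_def by (intro cmp_intros)
  ultimately have "cmp_on {z. \<exists>y. wit z y} (\<lambda>z. ans z (LEAST y. wit z y))"
    using cmp_comp_on by fastforce
  then obtain m b where ord: "\<And>k. ordinary (smn m b k)"
    and out: "\<And>k n u. pair (pair (pair m b) k) n \<in> {z. \<exists>y. wit z y} \<Longrightarrow>
      outp (smn m b k) u n (ans (pair (pair (pair m b) k) n) (LEAST y. wit (pair (pair (pair m b) k) n) y))"
    using smn_recursion by blast
  define R where "R = (\<lambda>c e. smn m b (pair c e))"
  have out_R: "outp (R c e) u n (reply m b c e n (LEAST y. witness c e y))" if "witness c e y" for c e u n y
    using out[of "pair c e" n u] that by (auto simp: R_def wit_def ans_def)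
  have out_R': "outp (R c e) u n (reply m b c e n (LEAST y. witness c e y))" if "pfst c \<noteq> 5" for c e u n
    using out_R[of c e 0] that by (simp add: witness_def)
  have "canonical_realiser R"
  proof
    show "ordinary (R c e)" for c e by (simp add: R_def ord)
    show "outp (R (fm_number (And \<phi> \<psi>)) e) u 0 (R (fm_number \<phi>) e)"
      "outp (R (fm_number (And \<phi> \<psi>)) e) u 1 (R (fm_number \<psi>) e)" for \<phi> \<psi> e u
      using out_R'[of "fm_number (And \<phi> \<psi>)" e u 0] out_R'[of "fm_number (And \<phi> \<psi>)" e u 1]
      by (simp_all add: reply_def R_def fm_number.simps)
    show "outp (R (fm_number (Or \<phi> \<psi>)) e) u 0 0 \<and>
      outp (R (fm_number (Or \<phi> \<psi>)) e) u 1 (R (fm_number \<phi>) e)"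
      if "eval_fm 0 e (fm_number \<phi>)" for \<phi> \<psi> e u
      using out_R'[of "fm_number (Or \<phi> \<psi>)" e u 0] out_R'[of "fm_number (Or \<phi> \<psi>)" e u 1] that
      by (simp add: reply_def R_def fm_number.simps)
    show "outp (R (fm_number (Or \<phi> \<psi>)) e) u 0 1 \<and>
      outp (R (fm_number (Or \<phi> \<psi>)) e) u 1 (R (fm_number \<psi>) e)"
      if "\<not> eval_fm 0 e (fm_number \<phi>)" for \<phi> \<psi> e u
      using out_R'[of "fm_number (Or \<phi> \<psi>)" e u 0] out_R'[of "fm_number (Or \<phi> \<psi>)" e u 1] that
      by (simp add: reply_def R_def fm_number.simps)
    show "outp (R (fm_number (Imp \<phi> \<psi>)) e) u n (R (fm_number \<psi>) e)" for \<phi> \<psi> e u n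
      using out_R'[of "fm_number (Imp \<phi> \<psi>)" e u n] by (simp add: reply_def R_def fm_number.simps)
    show "outp (R (fm_number (All \<phi>)) e) u n (R (fm_number \<phi>) (pair n e))" for \<phi> e u n
      using out_R'[of "fm_number (All \<phi>)" e u n] by (simp add: reply_def R_def fm_number.simps)
    show "\<exists>N m. eval_fm N (pair m e) (fm_number \<phi>) \<and>
        (\<forall>u. outp (R (fm_number (Ex \<phi>)) e) u 0 (R (fm_number \<phi>) (pair m e)) \<and>
             outp (R (fm_number (Ex \<phi>)) e) u 1 m)"
      if "eval_fm N (pair n e) (fm_number \<phi>)" for N n e \<phi>
    proof -
      let ?c = "fm_number (Ex \<phi>)"
      define y where "y = (LEAST y. witness ?c e y)"
      have w: "witness ?c e (pair N n)" using that by (simp add: witness_def fm_number.simps)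
      then have "witness ?c e y" unfolding y_def by (rule LeastI)
      then have "eval_fm (pfst y) (pair (psnd y) e) (fm_number \<phi>)" by (simp add: witness_def fm_number.simps)
      moreover have "outp (R ?c e) u 0 (R (fm_number \<phi>) (pair (psnd y) e))" "outp (R ?c e) u 1 (psnd y)" for u
        using out_R[OF w, of u 0] out_R[OF w, of u 1] unfolding y_def[symmetric]
        by (simp_all add: reply_def R_def fm_number.simps)
      ultimately show ?thesis by blast
    qed
  qed
  moreover have "cmp (\<lambda>z. R (pfst z) (psnd z))"
    unfolding R_def by (intro cmp_intros)
  ultimately show ?thesis by (rule that)
qed

theorem theorem1:
  shows
    "(\<exists>P Pinv. computable2 P \<and> computable2 Pinv \<and>
        (\<forall>\<phi>. pretty_Sigma1 \<phi> \<longrightarrow>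
          (\<forall>p. (realises p \<phi> \<longrightarrow> mu_realises_ge (P p (fm_number \<phi>)) \<phi> 1) \<and>
               (mu_realises p \<phi> \<longrightarrow> realises (Pinv p (fm_number \<phi>)) \<phi>))))
     \<and> (\<forall>\<phi>. pretty_Sigma1 \<phi> \<longrightarrow> (true_in_N \<phi> \<longleftrightarrow> (\<exists>p. mu_realises p \<phi>)))
     \<and> (\<exists>P Pinv. computable2 P \<and> computable2 Pinv \<and>
        (\<forall>\<phi>. universal_Pi1 \<phi> \<longrightarrow>
          (\<forall>p. (realises p \<phi> \<longrightarrow> mu_realises_ge (P p (fm_number \<phi>)) \<phi> 1) \<and>
               (mu_realises p \<phi> \<longrightarrow> realises (Pinv p (fm_number \<phi>)) \<phi>))))
     \<and> (\<forall>\<phi>. universal_Pi1 \<phi> \<longrightarrow> (true_in_N \<phi> \<longleftrightarrow> (\<exists>p. mu_realises p \<phi>)))"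
proof -
  obtain R where "canonical_realiser R" and cmp: "cmp (\<lambda>z. R (pfst z) (psnd z))"
    by (rule canonical_realiser_exists)
  then interpret canonical_realiser R by simp
  \<comment> \<open>The same function serves in both directions; 0 codes the constant zero
    assignment.\<close>
  define P where "P = (\<lambda>(p::nat) c. R c 0)"
  have "cmp (\<lambda>z. R (pfst (pair (psnd z) 0)) (psnd (pair (psnd z) 0)))"
    by (rule cmp_comp[OF cmp]) (intro cmp_intros)
  then have P: "computable2 P"
    unfolding P_def by (intro computable2I) simp
  have Sigma: "sound \<phi> \<and> complete \<phi>" if "pretty_Sigma1 \<phi>" for \<phi>
    using that pretty_Sigma1_adequate by (simp add: pretty_Sigma1_def)
  have Pi: "sound \<phi> \<and> complete \<phi>" if "universal_Pi1 \<phi>" for \<phi>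
    using that universal_Pi1_adequate by (simp add: universal_Pi1_def)
  have 1: "(realises p \<phi> \<longrightarrow> mu_realises_ge (P p (fm_number \<phi>)) \<phi> 1) \<and>
      (mu_realises p \<phi> \<longrightarrow> realises (P p (fm_number \<phi>)) \<phi>)"
    if "sound \<phi> \<and> complete \<phi>" for p \<phi>
    using adequate(1,2)[OF that] by (simp add: P_def)
  note 2 = adequate(3)
  show ?thesis
    using P 1[OF Sigma] 1[OF Pi] 2[OF Sigma] 2[OF Pi] by (intro conjI) blast+
qed

end
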